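(* Let $s,N\in\mathbb{N}$ and $\boldsymbol{z}\in\{1,\ldots,N-1\}^s$. Let $\alpha>1/2$ be real and let $\boldsymbol{\gamma}=(\gamma_u)_u$, $\boldsymbol{\gamma}'=(\gamma'_u)_u$ be families of non-negative real weights such that $\gamma_v\ge\gamma_u$ whenever $v\subset u$. Then $$D^*_{\boldsymbol{\gamma}',N}(\boldsymbol{z})\le\sum_{\emptyset\ne u\subseteq\{1,\ldots,s\}}\gamma'_u\left[1-\left(1-\frac1N\right)^{|u|}+\frac{(\rho_{\alpha,\boldsymbol{\gamma},N}(\boldsymbol{z}))^{1/(2\alpha)}}{2\gamma_u^{1/(2\alpha)}}\Bigl[\log 2\,(\log_2N)^{|u|}+3\,(2\log_2N)^{|u|-1}\Bigr]\right].$$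
   Context: $\mathbb{N}$ is the set of positive integers and $\log$ is the natural logarithm. Weights are families $\boldsymbol{\gamma}=(\gamma_u)$ of non-negative reals indexed by the finite non-empty subsets $u\subset\mathbb{N}$. For $\boldsymbol{z}\in\{1,\ldots,N-1\}^s$ (so $N\ge2$), the lattice point set $P(\boldsymbol{z})$ consists of the $N$ points (counted with multiplicity) $\boldsymbol{x}_n=(\{nz_1/N\},\ldots,\{nz_s/N\})$, $n=0,\ldots,N-1$, where $\{\cdot\}$ is the fractional part. Weighted star discrepancy: for a point set $P$ of $N$ points in $[0,1)^s$ and non-empty $u\subseteq\{1,\ldots,s\}$, let $P_u$ be the projection (with multiplicity) of $P$ onto the coordinates in $u$. For $\boldsymbol{y}_u\in[0,1)^{|u|}$ let $$\Delta_{P_u}(\boldsymbol{y}_u)=\frac1N\sum_{\boldsymbol{x}_u\in P_u}1_{[\boldsymbol{0},\boldsymbol{y}_u)}(\boldsymbol{x}_u)-\prod_{j\in u}y_j,\qquad [\boldsymbol{0},\boldsymbol{y}_u)=\prod_{j\in u}[0,y_j),$$ and $$D^*_{\boldsymbol{\gamma},N}(P)=\max_{\emptyset\ne u\subseteq\{1,\ldots,s\}}\gamma_u\sup_{\boldsymbol{y}_u\in[0,1)^{|u|}}|\Delta_{P_u}(\boldsymbol{y}_u)|.$$ Write $D^*_{\boldsymbol{\gamma},N}(\boldsymbol{z})=D^*_{\boldsymbol{\gamma},N}(P(\boldsymbol{z}))$. For non-empty $u\subseteq\{1,\ldots,s\}$ let $$P_u^\perp(\boldsymbol{z})=\Bigl\{\boldsymbol{k}_u\in(\mathbb{Z}\setminus\{0\})^{|u|}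 : \sum_{j\in u}k_jz_j\equiv0 \pmod N\Bigr\},$$ let $r_\alpha(\boldsymbol{\gamma},\boldsymbol{k}_u)=\gamma_u\prod_{j\in u}|k_j|^{-2\alpha}$, and let $$\rho_{\alpha,\boldsymbol{\gamma},N}(\boldsymbol{z})=\max_{\emptyset\ne u\subseteq\{1,\ldots,s\}}\ \max_{\boldsymbol{k}_u\in P_u^\perp(\boldsymbol{z})}r_\alpha(\boldsymbol{\gamma},\boldsymbol{k}_u).$$ Convention: $0/0=0$ for the ratio $\gamma'_u/\gamma_u^{1/(2\alpha)}$; if $\gamma_u=0<\gamma'_u$ for some non-empty $u\subseteq\{1,\ldots,s\}$, the right-hand side is read as $+\infty$. *)

theory Defs
  imports Complex_Main "HOL-Library.FuncSet" "HOL-Library.Indicator_Function"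
    "HOL-Library.Extended_Real" "HOL-Number_Theory.Cong"
begin

text \<open>
  Coordinates are indexed by \<open>1, \<dots>, s\<close>. A vector with index set \<open>u\<close> is an
  extensional function on \<open>u\<close>, and a point set of \<open>N\<close> points counted with multiplicity
  is a family \<open>P n\<close> with \<open>n < N\<close>. Weights are functions on sets of naturals, of which
  only the values at finite non-empty sets of positive integers matter.
\<close>

definition nonempty_subsets :: "nat \<Rightarrow> nat set set" where
  "nonempty_subsets s = Pow {1..s} - {{}}"

definition lattice_points :: "nat \<Rightarrow> (nat \<Rightarrow> nat) \<Rightarrow> nat \<Rightarrow> nat \<Rightarrow> real" where
  "lattice_points N z n j = frac (real n * real (z j) / real N)"

definition projection :: "nat set \<Rightarrow> (nat \<Rightarrow> nat \<Rightarrow> real) \<Rightarrow> nat \<Rightarrow> nat \<Rightarrow> real" where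
  "projection u P n = restrict (P n) u"

definition local_discrepancy ::
    "nat \<Rightarrow> (nat \<Rightarrow> nat \<Rightarrow> real) \<Rightarrow> nat set \<Rightarrow> (nat \<Rightarrow> real) \<Rightarrow> real" where
  "local_discrepancy N Q u y =
     1 / real N * (\<Sum>n<N. indicator (\<Pi>\<^sub>E j\<in>u. {0..<y j}) (Q n)) - (\<Prod>j\<in>u. y j)"

definition weighted_star_discrepancy ::
    "(nat set \<Rightarrow> real) \<Rightarrow> nat \<Rightarrow> nat \<Rightarrow> (nat \<Rightarrow> nat \<Rightarrow> real) \<Rightarrow> real" where
  "weighted_star_discrepancy \<gamma> s N P =
     Max ((\<lambda>u. \<gamma> u * (SUP y\<in>(\<Pi>\<^sub>E j\<in>u. {0..<1}).
       \<bar>local_discrepancy N (projection u P) u y\<bar>)) ` nonempty_subsets s)"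

definition dual_lattice :: "nat \<Rightarrow> (nat \<Rightarrow> nat) \<Rightarrow> nat set \<Rightarrow> (nat \<Rightarrow> int) set" where
  "dual_lattice N z u =
     {k \<in> (\<Pi>\<^sub>E j\<in>u. UNIV - {0}). [(\<Sum>j\<in>u. k j * int (z j)) = 0] (mod int N)}"

definition decay :: "real \<Rightarrow> (nat set \<Rightarrow> real) \<Rightarrow> nat set \<Rightarrow> (nat \<Rightarrow> int) \<Rightarrow> real" where
  "decay \<alpha> \<gamma> u k = \<gamma> u * (\<Prod>j\<in>u. real_of_int \<bar>k j\<bar> powr (- 2 * \<alpha>))"

text \<open>
  The inner maximum ranges over an infinite set, so it is written as a supremum; it is
  attained, see \<open>decay_SUP_attained\<close>.
\<close>

definition rho :: "real \<Rightarrow> (nat set \<Rightarrow> real) \<Rightarrow> nat \<Rightarrow> nat \<Rightarrow> (nat \<Rightarrow> nat) \<Rightarrow> real" where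
  "rho \<alpha> \<gamma> s N z =
     Max ((\<lambda>u. SUP k\<in>dual_lattice N z u. decay \<alpha> \<gamma> u k) ` nonempty_subsets s)"

lemma local_discrepancy_bound:
  assumes "y \<in> (\<Pi>\<^sub>E j\<in>u. {0..<1})"
  shows "\<bar>local_discrepancy N Q u y\<bar> \<le> 1"
proof -
  let ?S = "\<Sum>n<N. indicator (\<Pi>\<^sub>E j\<in>u. {0..<y j}) (Q n) :: real"
  have "?S \<le> (\<Sum>n<N. 1)"
    by (intro sum_mono) (auto simp: indicator_def)
  then have "?S \<le> real N" "0 \<le> ?S"
    by (auto intro: sum_nonneg)
  then have "0 \<le> 1 / real N * ?S" "1 / real N * ?S \<le> 1"
    by (cases "N = 0"; simp add: divide_simps)+
  moreover have "0 \<le> y j \<and> y j \<le> 1" if "j \<in> u" for j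
    using PiE_mem[OF assms that] by auto
  then have "0 \<le> (\<Prod>j\<in>u. y j)" "(\<Prod>j\<in>u. y j) \<le> 1"
    by (auto intro!: prod_nonneg prod_le_1)
  ultimately show ?thesis
    unfolding local_discrepancy_def by linarith
qed

lemma dual_lattice_nonempty:
  assumes "N \<ge> 1"
  shows "dual_lattice N z u \<noteq> {}"
proof -
  have "restrict (\<lambda>_. int N) u \<in> dual_lattice N z u"
    using assms unfolding dual_lattice_def
    by (auto simp: cong_0_iff intro!: dvd_sum)
  then show ?thesis by blast
qed

lemma decay_SUP_attained:
  assumes u: "finite u" and N: "N \<ge> 1" and \<alpha>: "\<alpha> > 0" and \<gamma>: "\<gamma> u \<ge> 0"
  shows "\<exists>k\<in>dual_lattice N z u. (SUP k\<in>dual_lattice N z u. decay \<alpha> \<gamma> u k) = decay \<alpha> \<gamma> u k"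
proof -
  let ?p = "\<lambda>k::nat \<Rightarrow> int. nat (\<Prod>j\<in>u. \<bar>k j\<bar>)"
  define D where "D = dual_lattice N z u"
  obtain k0 where k0: "k0 \<in> D" "\<And>k. k \<in> D \<Longrightarrow> ?p k0 \<le> ?p k"
    using dual_lattice_nonempty[OF N] ex_has_least_nat[of "\<lambda>k. k \<in> D" _ ?p]
    unfolding D_def by blast
  have dec: "decay \<alpha> \<gamma> u k = \<gamma> u * real (?p k) powr (- 2 * \<alpha>)" for k
  proof -
    have "real (?p k) = (\<Prod>j\<in>u. real_of_int \<bar>k j\<bar>)"
      by (simp add: prod_nonneg)
    then show ?thesis
      unfolding decay_def by (simp add: prod_powr_distrib)
  qed
  have pos: "?p k0 > 0"
  proof -
    have "\<forall>j\<in>u. k0 j \<noteq> 0"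
      using k0(1) unfolding D_def dual_lattice_def by auto
    then have "0 < (\<Prod>j\<in>u. \<bar>k0 j\<bar>)" by (auto intro!: prod_pos)
    then show ?thesis by simp
  qed
  have le: "decay \<alpha> \<gamma> u k \<le> decay \<alpha> \<gamma> u k0" if "k \<in> D" for k
  proof -
    have p: "0 < real (?p k0)" "real (?p k0) \<le> real (?p k)"
      using k0(2)[OF that] pos by (simp_all only: of_nat_le_iff of_nat_0_less_iff)
    have "- 2 * \<alpha> \<le> 0"
      using \<alpha> by simp
    then have "real (?p k) powr (- 2 * \<alpha>) \<le> real (?p k0) powr (- 2 * \<alpha>)"
      using p by (rule powr_mono2')
    then show ?thesis
      unfolding dec using \<gamma> by (rule mult_left_mono)
  qed
  have "(SUP k\<in>D. decay \<alpha> \<gamma> u k) = decay \<alpha> \<gamma> u k0"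
    by (rule cSup_eq_maximum) (use k0(1) le in auto)
  then show ?thesis using k0(1) unfolding D_def by blast
qed

end

theory Submission
  imports Defs "HOL-Analysis.Harmonic_Numbers"
begin

text \<open>
  Write \<open>L = log\<^sub>2 N\<close> and \<open>\<tau> = (\<gamma>\<^sub>u / \<rho>)\<^sup>1\<^sup>/\<^sup>2\<^sup>\<alpha>\<close>. Since \<open>\<gamma>\<close> is monotone, every
  non-zero \<open>d\<close> supported in \<open>u\<close> with \<open>d \<cdot> z \<equiv> 0\<close> modulo \<open>N\<close> satisfies \<open>\<Prod> max 1 |d\<^sub>j| \<ge> \<tau>\<close>.
  Rounding \<open>y\<close> up to multiples of \<open>1/N\<close> costs \<open>1 - (1 - 1/N)\<^bsup>|u|\<^esup>\<close>; the remaining error is, by the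
  discrete Fourier transform, at most the sum over non-zero dual vectors \<open>k\<close> with
  \<open>-N/2 < k\<^sub>j \<le> N/2\<close> of \<open>\<Prod> c(k\<^sub>j)\<close>, where \<open>c(0) = 1\<close> and \<open>c(k) = 1/(3|k|) + 2|k|/(3N\<^sup>2)\<close> dominates
  \<open>1/(N sin(\<pi>|k|/N))\<close>. (The cruder \<open>1/(2|k|)\<close> would lose a factor 2 in the leading term.)

  All coordinates but one are cut into dyadic cells. Two dual vectors in one box of volume
  \<open>V < \<tau>\<close> differ by at least \<open>\<tau>/V\<close> in the remaining coordinate, because their difference is dual
  as well; a box with \<open>V \<ge> \<tau>\<close> is first subdivided into boxes of volume in \<open>[\<tau>/2, \<tau>)\<close>. Summing over
  the boxes gives the claim when \<open>L \<ge> 3(|u| - 1)\<close>, and \<open>L \<ge> 4\<close> for \<open>|u| = 2\<close>. If \<open>L\<close> is smaller,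
  then \<open>\<tau> \<le> N\<close> makes the right-hand side exceed the trivial bound 1. For \<open>|u| = 1\<close> the points are
  counted directly.
\<close>


section \<open>Fourier coefficients of discrete intervals\<close>

text \<open>
  \<open>sin (3x) = 3 sin x - 4 sin\<^sup>3 x\<close> with \<open>x = \<pi>t/3\<close>, together with \<open>sin x \<ge> t\<close>, which is
  concavity of the sine on \<open>[0, \<pi>/6]\<close>.
\<close>

lemma sin_pi_ge_cubic:
  fixes t :: real
  assumes "0 \<le> t" "t \<le> 1 / 2"
  shows "3 * t - 4 * t ^ 3 \<le> sin (pi * t)"
proof -
  define x where "x = pi * t / 3"
  have x: "0 \<le> x" "x \<le> pi / 6"
    using assms by (auto simp: x_def field_simps)
  define y where "y = sin x"
  have "t \<le> y"
  proof (cases "t = 0 \<or> t = 1/2")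
    case True
    moreover have "pi * (1 / 2) / 3 = pi / 6"
      by simp
    ultimately show ?thesis
      unfolding y_def x_def using sin_30 by (elim disjE) (metis div_0 mult_zero_right order_refl sin_zero, metis order_refl)
  next
    case False
    then have x': "0 < x" "x < pi / 6"
      using assms by (auto simp: x_def field_simps)
    have D: "(sin has_real_derivative cos c) (at c)" for c :: real
      by (rule DERIV_sin)
    \<comment> \<open>The mean slope of the sine on \<open>[0, x]\<close> is at least that on
      \<open>[x, pi/6]\<close>, as the cosine decreases; so the graph lies above its chord from 0 to
      \<open>pi/6\<close>.\<close>
    obtain c1 where c1: "0 < c1" "c1 < x" "sin x - sin 0 = (x - 0) * cos c1"
      using MVT2[of 0 x sin cos] x' D by blast
    obtain c2 where c2: "x < c2" "c2 < pi / 6" "sin (pi / 6) - sin x = (pi / 6 - x) * cos c2"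
      using MVT2[of x "pi / 6" sin cos] x' D by blast
    have "cos c2 \<le> cos c1"
      using c1 c2 pi_gt_zero by (intro cos_monotone_0_pi_le) linarith+
    then have "(pi / 6 - x) * x * cos c2 \<le> (pi / 6 - x) * x * cos c1"
      using x' by (intro mult_left_mono) auto
    then have "x * (1 / 2 - sin x) \<le> (pi / 6 - x) * sin x"
      using c1(3) c2(3) by (simp add: sin_30 mult.commute mult.left_commute)
    then have "x / 2 \<le> pi / 6 * sin x"
      by (simp add: algebra_simps)
    then show ?thesis
      by (simp add: x_def y_def)
  qed
  moreover have "y \<le> 1 / 2"
    using x sin_monotone_2pi_le[of x "pi / 6"] by (simp add: y_def sin_30)
  moreover have "sin (pi * t) = 3 * y - 4 * y ^ 3"
  proof -
    have "sin (pi * t) = sin (2 * x + x)"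
      by (simp add: x_def)
    also have "\<dots> = 3 * y * (1 - y ^ 2) - y ^ 3"
      unfolding sin_add sin_double cos_double y_def[symmetric]
      using sin_cos_squared_add[of x, folded y_def] by algebra
    finally show ?thesis
      by (simp add: algebra_simps power2_eq_square power3_eq_cube)
  qed
  \<comment> \<open>The cubic is nondecreasing on \<open>[0, 1/2]\<close>, as the second factor is
    non-negative there; so \<open>t \<le> y\<close> carries over to its values.\<close>
  moreover have "3 * y - 4 * y ^ 3 - (3 * t - 4 * t ^ 3) = (y - t) * (3 - 4 * (y * y + y * t + t * t))"
    by (simp add: algebra_simps power3_eq_cube)
  moreover have "y * y \<le> 1/2 * (1/2)" "y * t \<le> 1/2 * (1/2)" "t * t \<le> 1/2 * (1/2)"
    using assms calculation(1,2) by (intro mult_mono; simp)+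
  then have "0 \<le> (y - t) * (3 - 4 * (y * y + y * t + t * t))"
    using \<open>t \<le> y\<close> by (intro mult_nonneg_nonneg) auto
  ultimately show ?thesis by linarith
qed

text \<open>A complete residue system modulo \<open>N\<close>, balanced around 0. The strict bound
  on the left drops \<open>- N/2\<close>, which for even \<open>N\<close> is congruent to
  \<open>N/2\<close>.\<close>

definition residues_abs_le_half :: "nat \<Rightarrow> int set" where
  "residues_abs_le_half N = {k. - int N < 2 * k \<and> 2 * k \<le> int N}"

lemma finite_residues_abs_le_half: "finite (residues_abs_le_half N)"
  by (rule finite_subset[of _ "{- int N..int N}"]) (auto simp: residues_abs_le_half_def)

section \<open>Additive characters modulo \<open>N\<close>\<close>

definition unit_root :: "nat \<Rightarrow> int \<Rightarrow> complex" where
  "unit_root N h = cis (2 * pi * (real_of_int h / real N))"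

lemma unit_root_add: "unit_root N (h + k) = unit_root N h * unit_root N k"
  by (simp add: unit_root_def cis_mult add_divide_distrib distrib_left)

lemma unit_root_0 [simp]: "unit_root N 0 = 1"
  by (simp add: unit_root_def)

lemma unit_root_mult_nat: "unit_root N (int n * h) = unit_root N h ^ n"
  unfolding unit_root_def Complex.DeMoivre by (simp add: mult_ac)

lemma norm_unit_root [simp]: "norm (unit_root N h) = 1"
  by (simp add: unit_root_def)

lemma unit_root_eq_1_iff:
  assumes "N > 0"
  shows "unit_root N h = 1 \<longleftrightarrow> int N dvd h"
proof
  assume "unit_root N h = 1"
  then have "cos (2 * pi * (real_of_int h / real N)) = 1"
    unfolding unit_root_def by (metis cis.simps(1) one_complex.simps(1))
  then obtain m where "2 * pi * (real_of_int h / real N) = real_of_int m * 2 * pi"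
    unfolding cos_one_2pi_int by blast
  then have "real_of_int h = real_of_int (m * int N)"
    using assms by (simp add: field_simps)
  then show "int N dvd h"
    by (simp only: of_int_eq_iff dvd_triv_right)
next
  assume "int N dvd h"
  then obtain m where "h = int N * m" by (elim dvdE)
  then show "unit_root N h = 1"
    using assms cis_multiple_2pi[of "of_int m"] by (simp add: unit_root_def)
qed

text \<open>Orthogonality: if \<open>N\<close> does not divide \<open>h\<close>, the sum is
  geometric and its ratio is an \<open>N\<close>-th root of unity other than 1.\<close>

lemma sum_unit_root:
  assumes "N > 0"
  shows "(\<Sum>n<N. unit_root N (int n * h)) = (if int N dvd h then of_nat N else 0)"
proof (cases "int N dvd h")
  case True
  then have "unit_root N h = 1"
    using unit_root_eq_1_iff[OF assms] by simp
  then show ?thesis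
    using True by (simp add: unit_root_mult_nat)
next
  case False
  then have ne: "unit_root N h \<noteq> 1"
    using unit_root_eq_1_iff[OF assms] by simp
  have "unit_root N h ^ N = 1"
    using unit_root_eq_1_iff[OF assms, of "int N * h"] by (simp add: unit_root_mult_nat)
  then show ?thesis
    using ne False by (simp add: unit_root_mult_nat geometric_sum)
qed

lemma sum_unit_root_residues:
  assumes "N > 0"
  shows "(\<Sum>k\<in>residues_abs_le_half N. unit_root N (k * h)) = (if int N dvd h then of_nat N else 0)"
proof -
  have "(\<Sum>k\<in>residues_abs_le_half N. unit_root N (k * h)) = (\<Sum>n<N. unit_root N (int n * h))"
  proof (rule sum.reindex_bij_witness
      [where i = "\<lambda>n. if 2 * n \<le> N then int n else int n - int N" and
        j = "\<lambda>k. nat (if k < 0 then k + int N else k)"])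
    fix k assume "k \<in> residues_abs_le_half N"
    moreover have "unit_root N (int N * h) = 1"
      using unit_root_eq_1_iff[OF assms, of "int N * h"] by simp
    ultimately show "unit_root N (int (nat (if k < 0 then k + int N else k)) * h) = unit_root N (k * h)"
      by (auto simp: residues_abs_le_half_def distrib_right unit_root_add)
  qed (use assms in \<open>auto simp: residues_abs_le_half_def\<close>)
  then show ?thesis
    using sum_unit_root[OF assms] by simp
qed

text \<open>Fourier coefficients of the indicator of \<open>{0..<M}\<close> on the integers modulo \<open>N\<close>.\<close>

definition initial_coeff :: "nat \<Rightarrow> nat \<Rightarrow> int \<Rightarrow> complex" where
  "initial_coeff N M k = (\<Sum>t<M. unit_root N (- (int t * k))) / of_nat N"

text \<open>Discrete Fourier inversion: after exchanging the sums, orthogonality leaves only the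
  \<open>t < M\<close> with \<open>t = x mod N\<close>.\<close>

lemma of_bool_mod_less_eq_sum:
  assumes "N > 0" "M \<le> N"
  shows "of_bool (x mod N < M) =
    (\<Sum>k\<in>residues_abs_le_half N. initial_coeff N M k * unit_root N (k * int x))"
proof -
  let ?K = "residues_abs_le_half N"
  have "(\<Sum>k\<in>?K. initial_coeff N M k * unit_root N (k * int x)) =
      (\<Sum>k\<in>?K. \<Sum>t<M. unit_root N (k * (int x - int t)) / of_nat N)"
    unfolding initial_coeff_def sum_divide_distrib sum_distrib_right
    by (intro sum.cong refl) (simp add: unit_root_add[symmetric] algebra_simps)
  also have "\<dots> = (\<Sum>t<M. \<Sum>k\<in>?K. unit_root N (k * (int x - int t)) / of_nat N)"
    by (rule sum.swap)
  also have "\<dots> = (\<Sum>t<M. of_bool (t = x mod N))"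
  proof (intro sum.cong refl)
    fix t assume "t \<in> {..<M}"
    then have "int N dvd (int x - int t) \<longleftrightarrow> t = x mod N"
      using assms by (auto simp: mod_eq_dvd_iff[symmetric] of_nat_mod[symmetric] simp del: of_nat_mod)
    then show "(\<Sum>k\<in>?K. unit_root N (k * (int x - int t)) / of_nat N) = of_bool (t = x mod N)"
      using assms by (simp add: sum_divide_distrib[symmetric] sum_unit_root_residues)
  qed
  also have "\<dots> = of_bool (x mod N < M)"
    by (simp add: of_bool_def)
  finally show ?thesis by simp
qed

text \<open>For \<open>k \<noteq> 0\<close> this is \<open>(1/(3t) + 2t/3) / N\<close> with
  \<open>t = |k|/N\<close>, a majorant of \<open>1 / (N * (3t - 4t^3))\<close> on
  \<open>0 < t \<le> 1/2\<close> that is exact at \<open>t = 1/2\<close>.\<close>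

definition coeff_bound :: "nat \<Rightarrow> int \<Rightarrow> real" where
  "coeff_bound N k =
    (if k = 0 then 1 else 1 / (3 * \<bar>real_of_int k\<bar>) + 2 * \<bar>real_of_int k\<bar> / (3 * real N ^ 2))"

lemma norm_unit_root_minus_1:
  "norm (unit_root N h - 1) = 2 * \<bar>sin (pi * (real_of_int h / real N))\<bar>"
proof -
  define x where "x = pi * (real_of_int h / real N)"
  have "(norm (unit_root N h - 1))^2 = (cos (2 * x) - 1)^2 + (sin (2 * x))^2"
    unfolding cmod_power2 by (simp add: unit_root_def x_def mult.assoc)
  also have "\<dots> = (2 * sin x)^2"
    using sin_cos_squared_add[of x] unfolding cos_double_sin sin_double by algebra
  finally have "sqrt ((norm (unit_root N h - 1))^2) = sqrt ((2 * sin x)^2)"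
    by simp
  then show ?thesis
    unfolding real_sqrt_abs by (simp add: x_def abs_mult)
qed

text \<open>The geometric sum has numerator at most 2 and denominator \<open>2 sin(pi t)\<close>
  with \<open>t = |k|/N\<close>; the cubic lower bound for the sine leaves an inequality between
  rational functions of \<open>t\<close>.\<close>

lemma norm_initial_coeff_le:
  assumes "N > 0" "M \<le> N" "2 * \<bar>k\<bar> \<le> int N"
  shows "norm (initial_coeff N M k) \<le> coeff_bound N k"
proof (cases "k = 0")
  case True
  then show ?thesis
    using assms by (simp add: initial_coeff_def coeff_bound_def norm_divide)
next
  case False
  define t where "t = \<bar>real_of_int k\<bar> / real N"
  have "real_of_int (2 * \<bar>k\<bar>) \<le> real_of_int (int N)"
    using assms(3) by (simp only: of_int_le_iff)
  then have t: "0 < t" "t \<le> 1 / 2"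
    using False assms(1) by (auto simp: t_def field_simps)
  have tt: "t ^ 2 \<le> (1 / 2) ^ 2"
    using t by (intro power_mono) auto
  define D where "D = 3 * t - 4 * t ^ 3"
  have D: "D = t * (3 - 4 * t ^ 2)"
    by (simp add: D_def algebra_simps power2_eq_square power3_eq_cube)
  have pos: "0 < D"
    unfolding D using t tt by (intro mult_pos_pos) (auto simp: power2_eq_square)
  define q where "q = unit_root N (- k)"
  have "norm (q - 1) = 2 * \<bar>sin (pi * t)\<bar>"
    unfolding q_def norm_unit_root_minus_1 t_def by (cases "k \<ge> 0") (auto simp: sin_minus)
  then have q: "norm (q - 1) \<ge> 2 * D"
    using sin_pi_ge_cubic[of t] t by (simp add: D_def)
  then have "q \<noteq> 1"
    using pos by auto
  then have "(\<Sum>i<M. unit_root N (- (int i * k))) = (q ^ M - 1) / (q - 1)"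
    using unit_root_mult_nat[of N _ "- k"] by (simp add: q_def geometric_sum)
  then have "norm (initial_coeff N M k) = norm (q ^ M - 1) / norm (q - 1) / real N"
    by (simp add: initial_coeff_def norm_divide norm_mult)
  also have "norm (q ^ M - 1) \<le> 2"
    using norm_triangle_ineq4[of "q ^ M" 1] by (simp add: norm_power q_def)
  then have "norm (q ^ M - 1) / norm (q - 1) / real N \<le> 2 / (2 * D) / real N"
    using q pos by (intro divide_right_mono frac_le) auto
  also have "2 / (2 * D) \<le> 1 / (3 * t) + 2 * t / 3"
  proof -
    have "(1 / (3 * t) + 2 * t / 3) * D = 1 + 2 / 3 * t ^ 2 * (1 - 4 * t ^ 2)"
      using t by (simp add: D field_simps power2_eq_square)
    moreover have "0 \<le> 2 / 3 * t ^ 2 * (1 - 4 * t ^ 2)"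
      using tt by (simp add: power2_eq_square)
    ultimately have "1 \<le> (1 / (3 * t) + 2 * t / 3) * D"
      by linarith
    then have "1 / D \<le> 1 / (3 * t) + 2 * t / 3"
      using pos by (simp only: pos_divide_le_eq)
    then show ?thesis
      by simp
  qed
  then have "2 / (2 * D) / real N \<le> (1 / (3 * t) + 2 * t / 3) / real N"
    by (rule divide_right_mono) simp
  also have "\<dots> = coeff_bound N k"
    using False assms(1) by (simp add: coeff_bound_def t_def field_simps power2_eq_square)
  finally show ?thesis .
qed

section \<open>Fourier expansion of the counting function\<close>

text \<open>In contrast to \<open>dual_lattice\<close>, single coordinates may vanish, so the
  support may be any non-empty subset of \<open>u\<close>.\<close>

definition nonzero_dual_residues :: "nat \<Rightarrow> (nat \<Rightarrow> nat) \<Rightarrow> nat set \<Rightarrow> (nat \<Rightarrow> int) set" where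
  "nonzero_dual_residues N z u =
    {k \<in> (\<Pi>\<^sub>E j\<in>u. residues_abs_le_half N).
      (\<exists>j\<in>u. k j \<noteq> 0) \<and> int N dvd (\<Sum>j\<in>u. k j * int (z j))}"

lemma finite_nonzero_dual_residues:
  assumes "finite u"
  shows "finite (nonzero_dual_residues N z u)"
proof (rule finite_subset)
  show "finite (\<Pi>\<^sub>E j\<in>u. residues_abs_le_half N)"
    using assms finite_residues_abs_le_half by (intro finite_PiE) auto
qed (auto simp: nonzero_dual_residues_def)

text \<open>Since the fractional part of \<open>n z_j / N\<close> is
  \<open>(n z_j mod N) / N\<close>, this counts the lattice points in the box with side lengths
  \<open>M j / N\<close>.\<close>

definition lattice_count :: "nat \<Rightarrow> (nat \<Rightarrow> nat) \<Rightarrow> nat set \<Rightarrow> (nat \<Rightarrow> nat) \<Rightarrow> real" where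
  "lattice_count N z u M = (\<Sum>n<N. of_bool (\<forall>j\<in>u. n * z j mod N < M j))"

text \<open>Multiplying the one-dimensional expansions and summing over \<open>n\<close> removes
  every frequency that is not dual. The zero frequency yields the volume of the box, the others the
  error.\<close>

lemma lattice_count_error_le_sum:
  assumes "finite u" "N > 0" and M: "\<And>j. j \<in> u \<Longrightarrow> M j \<le> N"
  shows "\<bar>lattice_count N z u M / real N - (\<Prod>j\<in>u. real (M j) / real N)\<bar>
    \<le> (\<Sum>k\<in>nonzero_dual_residues N z u. \<Prod>j\<in>u. coeff_bound N (k j))"
proof -
  define K where "K = (\<Pi>\<^sub>E j\<in>u. residues_abs_le_half N)"
  define \<Lambda> where "\<Lambda> = nonzero_dual_residues N z u"
  define c where "c k = (\<Prod>j\<in>u. initial_coeff N (M j) (k j))" for k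
  define S where "S k = (\<Sum>j\<in>u. k j * int (z j))" for k
  define k0 where "k0 = restrict (\<lambda>_. 0 :: int) u"
  have finK: "finite K"
    unfolding K_def using assms(1) finite_residues_abs_le_half by (intro finite_PiE) auto
  have prod_root: "(\<Prod>j\<in>u. unit_root N (h j)) = unit_root N (\<Sum>j\<in>u. h j)" for h
    using assms(1) by (induction u rule: finite_induct) (auto simp: unit_root_add)
  have expand: "of_bool (\<forall>j\<in>u. n * z j mod N < M j) = (\<Sum>k\<in>K. c k * unit_root N (int n * S k))" for n
  proof -
    have "of_bool (\<forall>j\<in>u. n * z j mod N < M j) = (\<Prod>j\<in>u. of_bool (n * z j mod N < M j) :: complex)"
      using assms(1) by (induction u rule: finite_induct) (auto simp: of_bool_def)
    also have "\<dots> = (\<Prod>j\<in>u. \<Sum>k\<in>residues_abs_le_half N.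
        initial_coeff N (M j) k * unit_root N (k * int (n * z j)))"
      using assms(2) M by (intro prod.cong refl of_bool_mod_less_eq_sum) auto
    also have "\<dots> = (\<Sum>k\<in>K. \<Prod>j\<in>u. initial_coeff N (M j) (k j) * unit_root N (k j * int (n * z j)))"
      unfolding K_def using assms(1) finite_residues_abs_le_half by (intro prod_sum_PiE) auto
    also have "\<dots> = (\<Sum>k\<in>K. c k * unit_root N (int n * S k))"
      unfolding prod.distrib prod_root c_def S_def
      by (intro sum.cong refl) (simp add: sum_distrib_left mult_ac)
    finally show ?thesis .
  qed
  have "of_real (lattice_count N z u M) = (\<Sum>n<N. \<Sum>k\<in>K. c k * unit_root N (int n * S k))"
    by (simp add: lattice_count_def expand[symmetric])
  also have "\<dots> = (\<Sum>k\<in>K. c k * (\<Sum>n<N. unit_root N (int n * S k)))"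
    by (subst sum.swap) (simp add: sum_distrib_left)
  also have "\<dots> = (\<Sum>k\<in>K. if int N dvd S k then c k * of_nat N else 0)"
    by (intro sum.cong refl) (simp add: sum_unit_root[OF assms(2)])
  also have "\<dots> = (\<Sum>k\<in>{k \<in> K. int N dvd S k}. c k * of_nat N)"
    using finK by (rule sum.inter_filter[symmetric])
  also have "{k \<in> K. int N dvd S k} = insert k0 \<Lambda>"
  proof -
    have "k = k0" if "k \<in> K" "\<forall>j\<in>u. k j = 0" for k
      using that by (intro ext) (auto simp: K_def k0_def PiE_def extensional_def)
    moreover have "k0 \<in> K" "S k0 = 0"
      by (auto simp: K_def k0_def S_def residues_abs_le_half_def assms(2))
    ultimately show ?thesis
      by (auto simp: \<Lambda>_def nonzero_dual_residues_def K_def[symmetric] S_def[symmetric])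
  qed
  also have "(\<Sum>k\<in>insert k0 \<Lambda>. c k * of_nat N) = (c k0 + (\<Sum>k\<in>\<Lambda>. c k)) * of_nat N"
    using finite_nonzero_dual_residues[OF assms(1)]
    by (subst sum.insert) (auto simp: \<Lambda>_def nonzero_dual_residues_def k0_def sum_distrib_right distrib_right)
  also have "c k0 = of_real (\<Prod>j\<in>u. real (M j) / real N)"
    by (simp add: c_def k0_def initial_coeff_def)
  finally have "of_real (lattice_count N z u M / real N - (\<Prod>j\<in>u. real (M j) / real N)) = (\<Sum>k\<in>\<Lambda>. c k)"
    using assms(2) by (simp add: field_simps)
  then have "\<bar>lattice_count N z u M / real N - (\<Prod>j\<in>u. real (M j) / real N)\<bar> = norm (\<Sum>k\<in>\<Lambda>. c k)"
    by (metis norm_of_real)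
  also have "\<dots> \<le> (\<Sum>k\<in>\<Lambda>. norm (c k))"
    by (rule norm_sum)
  also have "\<dots> \<le> (\<Sum>k\<in>\<Lambda>. \<Prod>j\<in>u. coeff_bound N (k j))"
  proof (rule sum_mono)
    fix k assume "k \<in> \<Lambda>"
    then have "k \<in> (\<Pi>\<^sub>E j\<in>u. residues_abs_le_half N)"
      by (simp add: \<Lambda>_def nonzero_dual_residues_def)
    then have "2 * \<bar>k j\<bar> \<le> int N" if "j \<in> u" for j
      using PiE_mem[OF _ that] by (fastforce simp: residues_abs_le_half_def)
    then show "norm (c k) \<le> (\<Prod>j\<in>u. coeff_bound N (k j))"
      unfolding c_def prod_norm[symmetric] using assms(2) M
      by (intro prod_mono conjI norm_initial_coeff_le norm_ge_zero) auto
  qed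
  finally show ?thesis
    by (simp add: \<Lambda>_def)
qed

section \<open>Counting points in one coordinate\<close>

lemma sum_mult_mod_eq_sum:
  fixes h :: "nat \<Rightarrow> real"
  assumes "coprime a q" "q > 0"
  shows "(\<Sum>n<q. h (n * a mod q)) = (\<Sum>r<q. h r)"
proof -
  have inj: "inj_on (\<lambda>n. n * a mod q) {..<q}"
  proof (rule inj_onI)
    fix m n assume mn: "m \<in> {..<q}" "n \<in> {..<q}" "m * a mod q = n * a mod q"
    then have "[m = n] (mod q)"
      using assms cong_mult_rcancel_nat by (simp add: cong_def)
    then show "m = n"
      using mn by (simp add: cong_def)
  qed
  have "(\<lambda>n. n * a mod q) ` {..<q} = {..<q}"
    using inj assms(2) by (intro card_subset_eq) (auto simp: card_image)
  then show ?thesis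
    using sum.reindex[OF inj, of h] by simp
qed

lemma sum_mult_mod_eq:
  fixes h :: "nat \<Rightarrow> real"
  assumes "coprime a q" "q > 0"
  shows "(\<Sum>n<g * q. h (n * a mod q)) = real g * (\<Sum>r<q. h r)"
proof -
  have "(\<Sum>n<g * q. h (n * a mod q)) = (\<Sum>m<g. \<Sum>n = m * q..<m * q + q. h (n * a mod q))"
    by (rule sum.nat_group[symmetric])
  also have "\<dots> = (\<Sum>m<g. \<Sum>r<q. h r)"
  proof (rule sum.cong[OF refl])
    fix m
    have "(\<Sum>n = m * q..<m * q + q. h (n * a mod q)) = (\<Sum>n = 0..<q. h ((n + m * q) * a mod q))"
      using sum.shift_bounds_nat_ivl[of "\<lambda>n. h (n * a mod q)" 0 "m * q" q] by (simp add: add.commute)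
    also have "\<dots> = (\<Sum>n<q. h (n * a mod q))"
      by (simp add: distrib_right atLeast0LessThan mult.assoc mult.left_commute[of m])
    finally show "(\<Sum>n = m * q..<m * q + q. h (n * a mod q)) = (\<Sum>r<q. h r)"
      using sum_mult_mod_eq_sum[OF assms] by simp
  qed
  finally show ?thesis
    by simp
qed

text \<open>With \<open>g = gcd (z i) N\<close>, the residues \<open>n * z i mod N\<close> run
  \<open>g\<close> times through the multiples of \<open>g\<close> below \<open>N\<close>, so the
  count is \<open>M i\<close> rounded up to a multiple of \<open>g\<close>.\<close>

lemma lattice_count_singleton_error:
  assumes "N > 0" "M i \<le> N"
  shows "\<bar>lattice_count N z {i} M / real N - real (M i) / real N\<bar> \<le> real (gcd (z i) N) / real N"
proof -
  define g where "g = gcd (z i) N"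
  define q where "q = N div g"
  define a where "a = z i div g"
  have g: "g > 0" and N: "N = g * q" and z: "z i = g * a"
    using assms(1) by (simp_all add: g_def q_def a_def)
  have q: "q > 0"
    using assms(1) N by (cases q) auto
  have cop: "coprime a q"
    unfolding a_def q_def g_def using assms(1) by (intro div_gcd_coprime) auto
  define R where "R = (M i + g - 1) div g"
  have mod_eq: "n * z i mod N = g * (n * a mod q)" for n
    by (simp only: z N mult.left_commute[of n g a] mult_mod_right)
  have "lattice_count N z {i} M = (\<Sum>n<N. of_bool (g * (n * a mod q) < M i))"
    by (simp only: lattice_count_def ball_simps simp_thms mod_eq)
  also have "\<dots> = (\<Sum>n<g * q. of_bool (g * (n * a mod q) < M i))"
    by (simp only: N)
  also have "\<dots> = real g * (\<Sum>r<q. of_bool (g * r < M i))"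
    using sum_mult_mod_eq[OF cop q, of "\<lambda>r. of_bool (g * r < M i)"] by simp
  also have "(\<Sum>r<q. of_bool (g * r < M i) :: real) = real (card {r. r < q \<and> g * r < M i})"
    by (simp add: of_bool_def sum.inter_filter[symmetric])
  also have "{r. r < q \<and> g * r < M i} = {..<R}"
  proof -
    have "g * r < M i \<longleftrightarrow> r < R" for r
    proof -
      have "r < R \<longleftrightarrow> Suc r * g \<le> M i + g - 1"
        unfolding R_def Suc_le_eq[symmetric] using g by (rule less_eq_div_iff_mult_less_eq)
      also have "\<dots> \<longleftrightarrow> g * r < M i"
        unfolding mult_Suc mult.commute[of r] using g by linarith
      finally show ?thesis by simp
    qed
    moreover have "r < q" if "g * r < M i" for r
    proof -
      have "g * r < g * q" using that assms(2) N by linarith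
      then show ?thesis by simp
    qed
    ultimately show ?thesis by auto
  qed
  finally have count: "lattice_count N z {i} M = real (g * R)"
    by simp
  have "g * R \<le> M i + g - 1"
    unfolding R_def by simp
  moreover have "M i + g - 1 < g * R + g"
    unfolding R_def using g dividend_less_times_div[of g "M i + g - 1"] by simp
  ultimately have "\<bar>real (g * R) - real (M i)\<bar> \<le> real g"
    using g by linarith
  then have "\<bar>real (g * R) - real (M i)\<bar> / real N \<le> real g / real N"
    by (intro divide_right_mono) auto
  then show ?thesis
    unfolding count g_def[symmetric] diff_divide_distrib[symmetric] by simp
qed

section \<open>Sums over separated integers\<close>

lemma coeff_bound_nonneg: "0 \<le> coeff_bound N k"
  by (simp add: coeff_bound_def)

lemma coeff_bound_le_half:
  assumes "k \<noteq> 0" "2 * \<bar>k\<bar> \<le> int N"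
  shows "coeff_bound N k \<le> 1 / (2 * \<bar>real_of_int k\<bar>)"
proof -
  define x where "x = \<bar>real_of_int k\<bar>"
  have "real_of_int (2 * \<bar>k\<bar>) \<le> real_of_int (int N)"
    using assms(2) by (simp only: of_int_le_iff)
  then have x: "0 < x" "2 * x \<le> real N"
    using assms by (simp_all add: x_def)
  then have "(2 * x) ^ 2 \<le> real N ^ 2"
    by (intro power_mono) auto
  then have "2 * x / (3 * real N ^ 2) \<le> 1 / (6 * x)"
    using x by (simp add: divide_simps power2_eq_square)
  moreover have "1 / (3 * x) + 1 / (6 * x) = 1 / (2 * x)"
    using x by (simp add: divide_simps)
  ultimately show ?thesis
    using assms(1) by (simp add: coeff_bound_def x_def[symmetric])
qed

text \<open>The second summand becomes a constant, so that the coefficient \<open>1/3\<close> of the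
  harmonic part survives; it produces the terms \<open>2/3 * ln\<close> below.\<close>

lemma coeff_bound_le_third:
  assumes "k \<noteq> 0" "2 * \<bar>k\<bar> \<le> int N"
  shows "coeff_bound N k \<le> 1 / (3 * \<bar>real_of_int k\<bar>) + 1 / (3 * real N)"
proof -
  define x where "x = \<bar>real_of_int k\<bar>"
  have "real_of_int (2 * \<bar>k\<bar>) \<le> real_of_int (int N)"
    using assms(2) by (simp only: of_int_le_iff)
  then have x: "0 < x" "2 * x \<le> real N"
    using assms by (simp_all add: x_def)
  then have "2 * x / (3 * real N ^ 2) \<le> real N / (3 * real N ^ 2)"
    by (intro divide_right_mono) auto
  also have "\<dots> = 1 / (3 * real N)"
    by (simp add: power2_eq_square)
  finally show ?thesis
    using assms(1) by (simp add: coeff_bound_def x_def[symmetric])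
qed

lemma sum_inverse_le_ln:
  assumes "n \<ge> 1"
  shows "(\<Sum>i=1..n. 1 / real i) \<le> 1 + ln (real n)"
  using assms
proof (induction n rule: dec_induct)
  case base
  then show ?case by simp
next
  case (step n)
  have "ln (real n / real (Suc n)) \<le> real n / real (Suc n) - 1"
    using step by (intro ln_le_minus_one) simp
  also have "\<dots> = - (1 / real (Suc n))"
    by (simp add: field_simps)
  also have "ln (real n / real (Suc n)) = ln (real n) - ln (real (Suc n))"
    using step.hyps by (simp add: ln_div)
  finally have "1 / real (Suc n) \<le> ln (real (Suc n)) - ln (real n)"
    by simp
  then show ?case
    using step.IH by (simp only: sum.cl_ivl_Suc) simp
qed

text \<open>
  Within distance \<open>\<delta>\<close> of the origin there is either only the point 0 or at most one point on
  each side.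
\<close>

lemma sum_near_le:
  fixes \<phi> :: "'a \<Rightarrow> int" and f :: "'a \<Rightarrow> real"
  assumes "finite Y" "0 \<le> C"
    and sep: "\<And>y y'. y \<in> Y \<Longrightarrow> y' \<in> Y \<Longrightarrow> y \<noteq> y' \<Longrightarrow> \<delta> \<le> \<bar>real_of_int (\<phi> y - \<phi> y')\<bar>"
    and near: "\<And>y. y \<in> Y \<Longrightarrow> \<bar>real_of_int (\<phi> y)\<bar> < \<delta>"
    and f: "\<And>y. y \<in> Y \<Longrightarrow> f y \<le> (if \<phi> y = 0 then C else C / 2)"
  shows "sum f Y \<le> C"
proof (cases "\<exists>y\<in>Y. \<phi> y = 0")
  case True
  then obtain y0 where y0: "y0 \<in> Y" "\<phi> y0 = 0" by blast
  have "Y = {y0}"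
    using sep[OF _ y0(1)] near y0 by fastforce
  then show ?thesis
    using f[OF y0(1)] y0(2) by simp
next
  case False
  have "inj_on (\<lambda>y. sgn (\<phi> y)) Y"
  proof (rule inj_onI)
    fix y y' assume y: "y \<in> Y" "y' \<in> Y" "sgn (\<phi> y) = sgn (\<phi> y')"
    show "y = y'"
    proof (rule ccontr)
      assume "y \<noteq> y'"
      then show False
        using sep[OF y(1,2)] near[OF y(1)] near[OF y(2)] y(3) by (auto simp: sgn_if split: if_splits)
    qed
  qed
  moreover have "(\<lambda>y. sgn (\<phi> y)) ` Y \<subseteq> {-1, 1}"
    using False by (auto simp: sgn_if)
  ultimately have "card Y \<le> card {-1, 1 :: int}"
    by (intro card_inj_on_le) auto
  then have "real (card Y) \<le> 2"
    by simp
  moreover have "sum f Y \<le> real (card Y) * (C / 2)"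
    using f False by (intro sum_bounded_above) auto
  ultimately show ?thesis
    using mult_right_mono[of "real (card Y)" 2 "C / 2"] assms(2) by linarith
qed

text \<open>The sign of \<open>\<phi> y\<close> and the integer part of
  \<open>|\<phi> y| / \<delta>\<close> determine \<open>y\<close>, since distinct points are
  \<open>\<delta>\<close> apart. This gives at most twice a harmonic sum over
  \<open>i * \<delta>\<close>. \<open>X\<close> is free so that it can be the exact ratio or the
  cruder \<open>N/2\<close>.\<close>

lemma sum_far_le:
  fixes \<phi> :: "'a \<Rightarrow> int"
  assumes "finite Y" "\<delta> \<ge> 1" "N \<ge> 1"
    and sep: "\<And>y y'. y \<in> Y \<Longrightarrow> y' \<in> Y \<Longrightarrow> y \<noteq> y' \<Longrightarrow> \<delta> \<le> \<bar>real_of_int (\<phi> y - \<phi> y')\<bar>"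
    and far: "\<And>y. y \<in> Y \<Longrightarrow> \<delta> \<le> \<bar>real_of_int (\<phi> y)\<bar>"
    and half: "\<And>y. y \<in> Y \<Longrightarrow> 2 * \<bar>\<phi> y\<bar> \<le> int N"
    and X: "real N / (2 * \<delta>) \<le> X" "1 \<le> X"
  shows "(\<Sum>y\<in>Y. coeff_bound N (\<phi> y)) \<le> (1 + 2 / 3 * ln X) / \<delta>"
proof -
  define m where "m = nat \<lfloor>real N / (2 * \<delta>)\<rfloor>"
  define i where "i y = nat \<lfloor>\<bar>real_of_int (\<phi> y)\<bar> / \<delta>\<rfloor>" for y
  define g where "g y = (sgn (\<phi> y), i y)" for y
  define h where "h i = 1 / (3 * (real i * \<delta>)) + 1 / (3 * real N)" for i
  have i: "real (i y) \<le> \<bar>real_of_int (\<phi> y)\<bar> / \<delta>" "\<bar>real_of_int (\<phi> y)\<bar> / \<delta> < real (i y) + 1" for y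
    using assms(2) floor_correct[of "\<bar>real_of_int (\<phi> y)\<bar> / \<delta>"] unfolding i_def by auto
  have i_ge: "i y \<ge> 1" if "y \<in> Y" for y
    proof -
    have "1 \<le> \<lfloor>\<bar>real_of_int (\<phi> y)\<bar> / \<delta>\<rfloor>"
      using far[OF that] assms(2) by (simp add: le_floor_iff)
    then show ?thesis
      unfolding i_def by linarith
  qed
  have i_le: "i y \<le> m" if "y \<in> Y" for y
  proof -
    have "real_of_int (2 * \<bar>\<phi> y\<bar>) \<le> real_of_int (int N)"
      using half[OF that] by (simp only: of_int_le_iff)
    then have "\<bar>real_of_int (\<phi> y)\<bar> / \<delta> \<le> real N / 2 / \<delta>"
      using assms(2) by (intro divide_right_mono) auto
    then show ?thesis
      unfolding i_def m_def by (intro nat_mono floor_mono) simp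
  qed
  have "inj_on g Y"
  proof (rule inj_onI)
    fix y y' assume y: "y \<in> Y" "y' \<in> Y" "g y = g y'"
    show "y = y'"
    proof (rule ccontr)
      assume "y \<noteq> y'"
      have "\<bar>\<bar>real_of_int (\<phi> y)\<bar> / \<delta> - \<bar>real_of_int (\<phi> y')\<bar> / \<delta>\<bar> < 1"
        using i[of y] i[of y'] y(3) unfolding g_def prod.inject abs_diff_less_iff by linarith
      then have "\<bar>\<bar>real_of_int (\<phi> y)\<bar> - \<bar>real_of_int (\<phi> y')\<bar>\<bar> < \<delta>"
        using assms(2) by (simp add: diff_divide_distrib[symmetric] abs_divide)
      then show False
        using sep[OF y(1,2) \<open>y \<noteq> y'\<close>] y(3) unfolding g_def prod.inject sgn_if
        by (simp split: if_splits)
    qed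
  qed
  moreover have "g ` Y \<subseteq> {-1, 1} \<times> {1..m}"
    
  proof (rule image_subsetI)
    fix y assume "y \<in> Y"
    moreover from this have "\<phi> y \<noteq> 0"
      using far[of y] assms(2) by auto
    ultimately show "g y \<in> {-1, 1} \<times> {1..m}"
      using i_ge i_le by (simp add: g_def sgn_if)
  qed
  moreover have "coeff_bound N (\<phi> y) \<le> h (snd (g y))" if "y \<in> Y" for y
  proof -
    have "real (i y) * \<delta> \<le> \<bar>real_of_int (\<phi> y)\<bar>"
      using i(1)[of y] assms(2) by (simp add: field_simps)
    moreover have "0 < real (i y) * \<delta>"
      using i_ge[OF that] assms(2) by simp
    ultimately have "1 / (3 * \<bar>real_of_int (\<phi> y)\<bar>) \<le> 1 / (3 * (real (i y) * \<delta>))"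
      by (intro divide_left_mono) auto
    moreover have "\<phi> y \<noteq> 0"
      using far[OF that] assms(2) by auto
    ultimately show ?thesis
      using coeff_bound_le_third[OF _ half[OF that]] by (simp add: h_def g_def)
  qed
  ultimately have "(\<Sum>y\<in>Y. coeff_bound N (\<phi> y)) \<le> (\<Sum>y\<in>Y. h (snd (g y)))"
    by (intro sum_mono) auto
  also have "\<dots> = (\<Sum>p\<in>g ` Y. h (snd p))"
    using \<open>inj_on g Y\<close> by (simp add: sum.reindex)
  also have "\<dots> \<le> (\<Sum>p\<in>{-1, 1 :: int} \<times> {1..m}. h (snd p))"
    using \<open>g ` Y \<subseteq> _\<close> assms(2) by (intro sum_mono2) (auto simp: h_def)
  also have "\<dots> = (\<Sum>\<sigma>\<in>{-1, 1 :: int}. \<Sum>i=1..m. h i)"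
    unfolding sum.cartesian_product by (simp add: split_beta)
  also have "\<dots> = 2 * (\<Sum>i=1..m. h i)"
    by simp
  also have "(\<Sum>i=1..m. h i) = (\<Sum>i=1..m. 1 / real i) / (3 * \<delta>) + real m / (3 * real N)"
    by (simp add: h_def sum.distrib sum_divide_distrib mult_ac)
  \<comment> \<open>After doubling, the constants \<open>1/3\<close> and \<open>1/6\<close> add up
    to the 1 in the claim.\<close>
  also have "\<dots> \<le> (1 + ln X) / (3 * \<delta>) + 1 / (6 * \<delta>)"
  proof (intro add_mono divide_right_mono)
    have m: "real m \<le> real N / (2 * \<delta>)"
      using assms(2) floor_correct[of "real N / (2 * \<delta>)"] unfolding m_def by auto
    then show "real m / (3 * real N) \<le> 1 / (6 * \<delta>)"
      using assms(2,3) by (simp add: field_simps)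
    show "(\<Sum>i=1..m. 1 / real i) \<le> 1 + ln X"
    proof (cases "m = 0")
      case True
      then show ?thesis using X(2) by simp
    next
      case False
      then have "ln (real m) \<le> ln X"
        using m X by (subst ln_le_cancel_iff) auto
      then show ?thesis
        using sum_inverse_le_ln[of m] False by simp
    qed
  qed (use assms(2) in auto)
  finally show ?thesis
    using assms(2) by (simp add: field_simps)
qed

section \<open>Dyadic cells\<close>

text \<open>By the convention \<open>log 2 0 = 0\<close>, the level of 0 is 0.\<close>

definition dyadic_level :: "int \<Rightarrow> nat" where
  "dyadic_level k = nat \<lfloor>log 2 (real_of_int \<bar>k\<bar>)\<rfloor>"

definition dyadic_cell :: "int \<Rightarrow> int \<times> nat" where
  "dyadic_cell k = (sgn k, dyadic_level k)"

text \<open>With \<open>l = dyadic_level N\<close> these cells suffice: \<open>2 |k| \<le> N\<close>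
  keeps the level of a non-zero \<open>k\<close> below \<open>l\<close>.\<close>

definition dyadic_cells :: "nat \<Rightarrow> (int \<times> nat) set" where
  "dyadic_cells l = insert (0, 0) ({-1, 1} \<times> {..<l})"

text \<open>\<open>cell_weight N c / 2 ^ snd c\<close> bounds \<^const>\<open>coeff_bound\<close> on the cell \<open>c\<close>.\<close>

definition cell_weight :: "nat \<Rightarrow> int \<times> nat \<Rightarrow> real" where
  "cell_weight N c = (if fst c = 0 then 1 else 1 / 3 + 2 * 4 ^ snd c / (3 * real N ^ 2))"

text \<open>Numerators for the cruder estimate \<open>1/(2|k|)\<close>, in which the exact
  \<open>|k|\<close> is kept so that the product bound \<open>\<tau>\<close> can be applied.\<close>

definition cell_half :: "int \<times> nat \<Rightarrow> real" where
  "cell_half c = (if fst c = 0 then 1 else 1 / 2)"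

lemma dyadic_level_0 [simp]: "dyadic_level 0 = 0"
  by (simp add: dyadic_level_def log_def)

lemma fst_dyadic_cell_eq_0_iff [simp]: "fst (dyadic_cell k) = 0 \<longleftrightarrow> k = 0"
  by (simp add: dyadic_cell_def sgn_0_0)

lemma dyadic_level_bounds:
  assumes "k \<noteq> 0"
  shows "2 ^ dyadic_level k \<le> \<bar>k\<bar>" "\<bar>k\<bar> < 2 * 2 ^ dyadic_level k"
proof -
  define x where "x = real_of_int \<bar>k\<bar>"
  have x: "x \<ge> 1"
    using assms by (simp add: x_def)
  have "0 \<le> log 2 x"
    using x by simp
  then have l: "real (dyadic_level k) \<le> log 2 x" "log 2 x < real (dyadic_level k) + 1"
    unfolding dyadic_level_def x_def[symmetric] by linarith+
  have "2 powr real (dyadic_level k) \<le> x"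
    using l(1) x by (subst le_log_iff[symmetric]) auto
  then have "real_of_int (2 ^ dyadic_level k) \<le> real_of_int \<bar>k\<bar>"
    by (simp add: powr_realpow x_def)
  then show "2 ^ dyadic_level k \<le> \<bar>k\<bar>"
    by (simp only: of_int_le_iff)
  have "x < 2 powr real (Suc (dyadic_level k))"
    using l(2) x by (subst log_less_iff[symmetric]) auto
  then have "real_of_int \<bar>k\<bar> < real_of_int (2 * 2 ^ dyadic_level k)"
    by (subst (asm) powr_realpow) (simp_all add: x_def)
  then show "\<bar>k\<bar> < 2 * 2 ^ dyadic_level k"
    by (simp only: of_int_less_iff)
qed

lemma dyadic_cell_in_cells:
  assumes "2 * \<bar>k\<bar> \<le> int N" "N \<ge> 1"
  shows "dyadic_cell k \<in> dyadic_cells (dyadic_level (int N))"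
proof (cases "k = 0")
  case True
  then show ?thesis by (simp add: dyadic_cell_def dyadic_cells_def)
next
  case False
  have "2 * 2 ^ dyadic_level k \<le> int N"
    using dyadic_level_bounds(1)[OF False] assms by linarith
  moreover have "int N < 2 * 2 ^ dyadic_level (int N)"
    using dyadic_level_bounds(2)[of "int N"] assms(2) by simp
  ultimately have "(2::int) ^ dyadic_level k < 2 ^ dyadic_level (int N)"
    by linarith
  then have "dyadic_level k < dyadic_level (int N)"
    by (rule power_less_imp_less_exp[rotated]) simp
  then show ?thesis
    using False by (simp add: dyadic_cell_def dyadic_cells_def sgn_if)
qed

lemma finite_dyadic_cells: "finite (dyadic_cells l)"
  by (simp add: dyadic_cells_def)

lemma cell_weight_nonneg: "0 \<le> cell_weight N c"
  by (simp add: cell_weight_def)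

lemma cell_half_nonneg: "0 \<le> cell_half c"
  by (simp add: cell_half_def)

text \<open>The value of \<open>1/(3x) + 2x/(3N^2)\<close> at a point \<open>x\<close> of the cell
  is at most that at the lower end \<open>p\<close>, because \<open>2 p x \<le> N^2\<close>.\<close>

lemma coeff_bound_le_cell_weight:
  assumes "2 * \<bar>k\<bar> \<le> int N"
  shows "coeff_bound N k \<le> cell_weight N (dyadic_cell k) / 2 ^ snd (dyadic_cell k)"
proof (cases "k = 0")
  case True
  then show ?thesis
    by (simp add: coeff_bound_def cell_weight_def dyadic_cell_def)
next
  case False
  define x where "x = \<bar>real_of_int k\<bar>"
  define p :: real where "p = 2 ^ dyadic_level k"
  have "real_of_int (2 * \<bar>k\<bar>) \<le> real_of_int (int N)"
    using assms by (simp only: of_int_le_iff)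
  moreover have "real_of_int (2 ^ dyadic_level k) \<le> real_of_int \<bar>k\<bar>"
    using dyadic_level_bounds(1)[OF False] by (simp only: of_int_le_iff)
  ultimately have x: "2 * x \<le> real N" "p \<le> x" "0 < p"
    by (simp_all add: x_def p_def)
  have "(2 * p) * (2 * x) \<le> real N * real N"
    using x by (intro mult_mono) auto
  then have "4 * (p * x) \<le> real N ^ 2"
    by (simp add: power2_eq_square)
  moreover have "0 < p * x"
    using x by simp
  ultimately have "2 * (p * x) \<le> real N ^ 2"
    by linarith
  then have "(x - p) / 3 * (2 / real N ^ 2) \<le> (x - p) / 3 * (1 / (p * x))"
    using x by (intro mult_left_mono) (auto simp: divide_simps)
  also have "\<dots> = 1 / (3 * p) - 1 / (3 * x)"
    using x by (simp add: field_simps)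
  finally have "1 / (3 * x) + 2 * x / (3 * real N ^ 2) \<le> 1 / (3 * p) + 2 * p / (3 * real N ^ 2)"
    by (simp add: algebra_simps diff_divide_distrib)
  also have "\<dots> = (1 / 3 + 2 * (p * p) / (3 * real N ^ 2)) / p"
    using x(3) by (simp add: add_divide_distrib)
  also have "p * p = 4 ^ dyadic_level k"
    by (simp add: p_def power_mult_distrib[symmetric])
  finally show ?thesis
    using False by (simp add: coeff_bound_def cell_weight_def x_def p_def dyadic_cell_def sgn_0_0)
qed

lemma coeff_bound_le_cell_half:
  assumes "2 * \<bar>k\<bar> \<le> int N"
  shows "coeff_bound N k \<le> cell_half (dyadic_cell k) / real_of_int (max 1 \<bar>k\<bar>)"
proof (cases "k = 0")
  case True
  then show ?thesis by (simp add: coeff_bound_def cell_half_def)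
next
  case False
  then have "max 1 \<bar>k\<bar> = \<bar>k\<bar>" by simp
  then show ?thesis
    using coeff_bound_le_half[OF False assms] False by (simp add: cell_half_def)
qed

text \<open>At a level \<open>a\<close> below \<open>dyadic_level N\<close> one has
  \<open>4 * 4 ^ a \<le> N^2\<close>, so the second summand of the weight is at most
  \<open>1/6\<close>.\<close>

lemma cell_weight_le_cell_half:
  assumes "c \<in> dyadic_cells (dyadic_level (int N))" "N \<ge> 1"
  shows "cell_weight N c \<le> cell_half c"
proof (cases "fst c = 0")
  case True
  then show ?thesis by (simp add: cell_weight_def cell_half_def)
next
  case False
  then have "Suc (snd c) \<le> dyadic_level (int N)"
    using assms(1) by (auto simp: dyadic_cells_def)
  then have "(2::int) ^ Suc (snd c) \<le> 2 ^ dyadic_level (int N)"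
    by (rule power_increasing) simp
  also have "\<dots> \<le> int N"
    using dyadic_level_bounds(1)[of "int N"] assms(2) by simp
  finally have "real_of_int (2 ^ Suc (snd c)) \<le> real_of_int (int N)"
    by (simp only: of_int_le_iff)
  then have "(2 * 2 ^ snd c) * (2 * 2 ^ snd c) \<le> real N * real N"
    by (intro mult_mono) auto
  moreover have "(2 :: real) ^ snd c * 2 ^ snd c = 4 ^ snd c"
    by (simp add: power_mult_distrib[symmetric])
  ultimately have "4 * 4 ^ snd c \<le> real N ^ 2"
    by (simp add: power2_eq_square)
  then show ?thesis
    using False assms(2) by (simp add: cell_weight_def cell_half_def field_simps)
qed

lemma sum_dyadic_cells:
  "(\<Sum>c\<in>dyadic_cells l. f c) = f (0, 0) + (\<Sum>a<l. f (-1, a) + f (1, a))"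
  for f :: "int \<times> nat \<Rightarrow> real"
proof -
  have "(\<Sum>c\<in>dyadic_cells l. f c) = f (0, 0) + (\<Sum>c\<in>{-1, 1} \<times> {..<l}. f c)"
    unfolding dyadic_cells_def by (subst sum.insert) auto
  also have "(\<Sum>c\<in>{-1, 1} \<times> {..<l}. f c) = (\<Sum>\<sigma>\<in>{-1, 1}. \<Sum>a<l. f (\<sigma>, a))"
    unfolding sum.cartesian_product by (simp add: split_beta)
  finally show ?thesis
    by (simp add: sum.distrib)
qed

lemma sum_cell_half: "(\<Sum>c\<in>dyadic_cells l. cell_half c) = 1 + real l"
  by (simp add: sum_dyadic_cells cell_half_def)

text \<open>The zero cell gives 1, each level \<open>2/3\<close> from its two signs, and the second
  summands form a geometric series of sum at most \<open>4/9\<close>.\<close>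

lemma sum_cell_weight_le:
  assumes "N \<ge> 1"
  shows "(\<Sum>c\<in>dyadic_cells (dyadic_level (int N)). cell_weight N c)
    \<le> 13 / 9 + 2 / 3 * real (dyadic_level (int N))"
proof -
  define l where "l = dyadic_level (int N)"
  have "2 ^ l \<le> int N"
    using dyadic_level_bounds(1)[of "int N"] assms by (simp add: l_def)
  then have "real_of_int (2 ^ l) \<le> real_of_int (int N)"
    by (simp only: of_int_le_iff)
  then have "(2 ^ l) ^ 2 \<le> real N ^ 2"
    by (intro power_mono) auto
  then have N: "4 ^ l \<le> real N ^ 2"
    by (simp add: power2_eq_square power_mult_distrib[symmetric])
  have "(\<Sum>a<l. (4::real) ^ a) \<le> 4 ^ l / 3"
    by (simp add: geometric_sum divide_right_mono)
  then have "(\<Sum>a<l. (4::real) ^ a) \<le> real N ^ 2 / 3"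
    using N by linarith
  then have "(\<Sum>a<l. (4::real) ^ a) * (4 / (3 * real N ^ 2)) \<le> real N ^ 2 / 3 * (4 / (3 * real N ^ 2))"
    by (intro mult_right_mono) auto
  also have "\<dots> = 4 / 9"
    using assms by simp
  finally have "(\<Sum>a<l. (4::real) ^ a) * (4 / (3 * real N ^ 2)) \<le> 4 / 9" .
  moreover have "(\<Sum>c\<in>dyadic_cells l. cell_weight N c)
      = 1 + (\<Sum>a<l. 2 / 3 + 4 ^ a * (4 / (3 * real N ^ 2)))"
    by (simp add: sum_dyadic_cells cell_weight_def mult.commute)
  then have "(\<Sum>c\<in>dyadic_cells l. cell_weight N c)
      = 1 + (2 / 3 * real l + (\<Sum>a<l. (4::real) ^ a) * (4 / (3 * real N ^ 2)))"
    by (simp only: sum.distrib sum_distrib_right) simp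
  ultimately show ?thesis
    unfolding l_def by linarith
qed

lemma same_cell_diff:
  assumes "dyadic_cell k = c" "dyadic_cell k' = c"
  shows "max 1 \<bar>k - k'\<bar> \<le> 2 ^ snd c"
proof (cases "k = 0 \<or> k' = 0")
  case True
  then have "k = 0" "k' = 0"
    using assms by (metis fst_dyadic_cell_eq_0_iff)+
  then show ?thesis by simp
next
  case False
  have "sgn k = sgn k'" "dyadic_level k = snd c" "dyadic_level k' = snd c"
    using assms by (auto simp: dyadic_cell_def)
  then have "(k > 0 \<longleftrightarrow> k' > 0)" "2 ^ snd c \<le> \<bar>k\<bar>" "\<bar>k\<bar> < 2 * 2 ^ snd c"
    "2 ^ snd c \<le> \<bar>k'\<bar>" "\<bar>k'\<bar> < 2 * 2 ^ snd c"
    using dyadic_level_bounds[of k] dyadic_level_bounds[of k'] False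
    by (simp_all add: sgn_if split: if_splits)
  then have "\<bar>k - k'\<bar> < 2 ^ snd c"
    by linarith
  then show ?thesis by simp
qed

section \<open>Subdividing dyadic cells\<close>

lemma same_subcell_diff:
  assumes "dyadic_cell k = dyadic_cell k'" "\<bar>k\<bar> div 2 ^ b = \<bar>k'\<bar> div 2 ^ b"
  shows "max 1 \<bar>k - k'\<bar> \<le> 2 ^ b"
proof -
  have "sgn k = sgn k'"
    using assms(1) by (simp add: dyadic_cell_def)
  then have "\<bar>k - k'\<bar> = \<bar>\<bar>k\<bar> - \<bar>k'\<bar>\<bar>"
    by (simp add: sgn_if split: if_splits)
  moreover have "\<bar>k\<bar> = \<bar>k\<bar> div 2 ^ b * 2 ^ b + \<bar>k\<bar> mod 2 ^ b"
    "\<bar>k'\<bar> = \<bar>k\<bar> div 2 ^ b * 2 ^ b + \<bar>k'\<bar> mod 2 ^ b"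
    using assms(2) by (metis div_mult_mod_eq)+
  moreover have "0 \<le> \<bar>k\<bar> mod 2 ^ b" "\<bar>k\<bar> mod 2 ^ b < 2 ^ b"
    "0 \<le> \<bar>k'\<bar> mod 2 ^ b" "\<bar>k'\<bar> mod 2 ^ b < 2 ^ b"
    by simp_all
  ultimately have "\<bar>k - k'\<bar> < 2 ^ b"
    by linarith
  then show ?thesis by simp
qed

text \<open>The quotients \<open>|k| div 2 ^ b\<close> of the \<open>k\<close> in the cell
  \<open>c\<close>, for \<open>b \<le> snd c\<close>; they label subcells of length
  \<open>2 ^ b\<close>.\<close>

definition subcells :: "int \<times> nat \<Rightarrow> nat \<Rightarrow> int set" where
  "subcells c b = (if fst c = 0 then {0} else {2 ^ (snd c - b)..<2 * 2 ^ (snd c - b)})"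

lemma subcell_in_subcells:
  assumes "dyadic_cell k = c" "b \<le> snd c"
  shows "\<bar>k\<bar> div 2 ^ b \<in> subcells c b"
proof (cases "k = 0")
  case True
  then show ?thesis
    using assms by (auto simp: subcells_def)
next
  case False
  have p: "(2::int) ^ snd c = 2 ^ (snd c - b) * 2 ^ b"
    using assms(2) by (simp add: power_add[symmetric])
  have "2 ^ (snd c - b) * 2 ^ b \<le> \<bar>k\<bar>" "\<bar>k\<bar> < 2 * 2 ^ (snd c - b) * 2 ^ b"
    using dyadic_level_bounds[OF False] assms(1) unfolding p[symmetric] mult.assoc
    by (auto simp: dyadic_cell_def)
  moreover have "(\<bar>k\<bar> div 2 ^ b) * 2 ^ b \<le> \<bar>k\<bar>"
  proof -
    have "0 \<le> \<bar>k\<bar> mod 2 ^ b"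
      by simp
    then show ?thesis
      using div_mult_mod_eq[of "\<bar>k\<bar>" "2 ^ b"] by linarith
  qed
  ultimately have "(2 ^ (snd c - b) * 2 ^ b) div 2 ^ b \<le> \<bar>k\<bar> div 2 ^ b"
    "(\<bar>k\<bar> div 2 ^ b) * 2 ^ b < 2 * 2 ^ (snd c - b) * 2 ^ b"
    by (intro zdiv_mono1, simp_all only: zero_less_power zero_less_numeral)
  then have "2 ^ (snd c - b) \<le> \<bar>k\<bar> div 2 ^ b" "\<bar>k\<bar> div 2 ^ b < 2 * 2 ^ (snd c - b)"
    by simp_all
  moreover have "fst c \<noteq> 0"
    using assms(1) False by auto
  ultimately show ?thesis
    by (simp add: subcells_def)
qed

lemma card_subcells_le:
  assumes "b \<le> snd c"
  shows "finite (subcells c b)" "real (card (subcells c b)) \<le> 2 ^ snd c / 2 ^ b"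
proof -
  show "finite (subcells c b)"
    by (simp add: subcells_def)
  have "real (card (subcells c b)) \<le> 2 ^ (snd c - b)"
    by (simp add: subcells_def nat_power_eq)
  also have "\<dots> = 2 ^ snd c / 2 ^ b"
    using assms by (simp add: power_diff)
  finally show "real (card (subcells c b)) \<le> 2 ^ snd c / 2 ^ b" .
qed

text \<open>Distributes a total exponent over the coordinates, so that a large box can be cut into
  subboxes of volume exactly \<open>2 ^ t\<close>.\<close>

lemma exists_bounded_sum_eq:
  fixes a :: "'a \<Rightarrow> nat"
  assumes "finite u" "t \<le> (\<Sum>j\<in>u. a j)"
  shows "\<exists>b. (\<forall>j\<in>u. b j \<le> a j) \<and> (\<Sum>j\<in>u. b j) = t"
  using assms
proof (induction u arbitrary: t rule: finite_induct)
  case empty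
  then show ?case by simp
next
  case (insert i u)
  have "t - min t (a i) \<le> (\<Sum>j\<in>u. a j)"
    using insert.prems insert.hyps by simp
  from insert.IH[OF this] obtain b
    where b: "\<forall>j\<in>u. b j \<le> a j" "(\<Sum>j\<in>u. b j) = t - min t (a i)"
    by blast
  have "(\<Sum>j\<in>u. (b(i := min t (a i))) j) = (\<Sum>j\<in>u. b j)"
    using insert.hyps by (intro sum.cong) auto
  then show ?case
    using b insert.hyps by (intro exI[of _ "b(i := min t (a i))"]) auto
qed

section \<open>Dual vectors in a dyadic box\<close>

definition separated :: "nat set \<Rightarrow> real \<Rightarrow> (nat \<Rightarrow> int) set \<Rightarrow> bool" where
  "separated u \<tau> Y \<longleftrightarrow>
    (\<forall>y\<in>Y. \<tau> \<le> (\<Prod>j\<in>u. real_of_int (max 1 \<bar>y j\<bar>))) \<and>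
    (\<forall>y\<in>Y. \<forall>y'\<in>Y. y \<noteq> y' \<longrightarrow> \<tau> \<le> (\<Prod>j\<in>u. real_of_int (max 1 \<bar>y j - y' j\<bar>)))"

lemma separated_subset: "separated u \<tau> Y \<Longrightarrow> Z \<subseteq> Y \<Longrightarrow> separated u \<tau> Z"
  by (auto simp: separated_def)

text \<open>The coordinates in \<open>u\<close> contribute at most
  \<open>V = 2 ^ (\<Sum>j\<in>u. b j)\<close> to the product, so the remaining factor is at least
  \<open>\<tau> / V\<close>.\<close>

lemma separated_last_coordinate:
  assumes "finite u" "i \<notin> u" "separated (insert i u) \<tau> Y"
    and b: "\<And>y y' j. y \<in> Y \<Longrightarrow> y' \<in> Y \<Longrightarrow> j \<in> u \<Longrightarrow> max 1 \<bar>y j - y' j\<bar> \<le> 2 ^ b j"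
    and \<tau>: "2 ^ (\<Sum>j\<in>u. b j) < \<tau>"
    and y: "y \<in> Y" "y' \<in> Y" "y \<noteq> y'"
  shows "\<tau> / 2 ^ (\<Sum>j\<in>u. b j) \<le> \<bar>real_of_int (y i - y' i)\<bar>"
proof -
  define m where "m = real_of_int (max 1 \<bar>y i - y' i\<bar>)"
  define V :: real where "V = 2 ^ (\<Sum>j\<in>u. b j)"
  have "\<tau> \<le> (\<Prod>j\<in>insert i u. real_of_int (max 1 \<bar>y j - y' j\<bar>))"
    using assms(3) y by (simp add: separated_def)
  also have "\<dots> = m * (\<Prod>j\<in>u. real_of_int (max 1 \<bar>y j - y' j\<bar>))"
    using assms(1,2) by (simp add: m_def)
  also have "(\<Prod>j\<in>u. real_of_int (max 1 \<bar>y j - y' j\<bar>)) \<le> (\<Prod>j\<in>u. 2 ^ b j)"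
  proof (intro prod_mono conjI)
    fix j assume "j \<in> u"
    then have "real_of_int (max 1 \<bar>y j - y' j\<bar>) \<le> real_of_int (2 ^ b j)"
      using b[OF y(1,2)] by (simp only: of_int_le_iff)
    then show "real_of_int (max 1 \<bar>y j - y' j\<bar>) \<le> 2 ^ b j"
      by simp
  qed simp
  also have "(\<Prod>j\<in>u. 2 ^ b j) = V"
    by (simp add: power_sum V_def)
  finally have le: "\<tau> \<le> m * V"
    by (simp add: m_def mult_left_mono)
  \<comment> \<open>\<open>V < \<tau>\<close> excludes the value 1 that \<open>max\<close> could
    supply, so \<open>m\<close> is the genuine distance in coordinate \<open>i\<close>.\<close>
  have "m \<noteq> 1"
    using le \<tau> by (auto simp: V_def)
  then have "m = \<bar>real_of_int (y i - y' i)\<bar>"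
    unfolding m_def by (simp add: max_def split: if_splits)
  then show ?thesis
    using le by (simp add: V_def field_simps)
qed

text \<open>Vectors near 0 and far from 0 in coordinate \<open>i\<close> are estimated separately,
  once for boxes of volume below \<open>\<tau>\<close> and once for larger ones. The constant
  \<open>2 - 2/3 * ln 2\<close> comes from the larger ones.\<close>

lemma box_sum_le:
  fixes c :: "nat \<Rightarrow> int \<times> nat"
  assumes u: "finite u" "i \<notin> u" and N: "N \<ge> 4" and \<tau>: "1 < \<tau>"
    and Y: "finite Y" "separated (insert i u) \<tau> Y"
    and half: "\<And>y j. y \<in> Y \<Longrightarrow> j \<in> insert i u \<Longrightarrow> 2 * \<bar>y j\<bar> \<le> int N"
    and c: "\<And>y j. y \<in> Y \<Longrightarrow> j \<in> u \<Longrightarrow> dyadic_cell (y j) = c j"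
    and c': "\<And>j. j \<in> u \<Longrightarrow> c j \<in> dyadic_cells (dyadic_level (int N))"
  shows "(\<Sum>y\<in>Y. \<Prod>j\<in>insert i u. coeff_bound N (y j)) \<le>
    ((2 - 2 / 3 * ln 2) * (\<Prod>j\<in>u. cell_half (c j))
      + (\<Prod>j\<in>u. cell_weight N (c j)) * (1 + 2 / 3 * ln (real N / 2))) / \<tau>"
proof -
  define W where "W = (\<Prod>j\<in>u. cell_weight N (c j))"
  define H where "H = (\<Prod>j\<in>u. cell_half (c j))"
  define A where "A = (\<Sum>j\<in>u. snd (c j))"
  define f where "f y = (\<Prod>j\<in>insert i u. coeff_bound N (y j))" for y
  have W: "0 \<le> W"
    by (simp add: W_def prod_nonneg cell_weight_nonneg)
  have H: "0 \<le> H"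
    by (simp add: H_def prod_nonneg cell_half_nonneg)
  have WH: "W \<le> H"
    unfolding W_def H_def using c' N
    by (intro prod_mono conjI cell_weight_nonneg cell_weight_le_cell_half) auto
  have f_le: "f y \<le> W / 2 ^ A * coeff_bound N (y i)" if "y \<in> Y" for y
  proof -
    have "(\<Prod>j\<in>u. coeff_bound N (y j)) \<le> (\<Prod>j\<in>u. cell_weight N (c j) / 2 ^ snd (c j))"
    proof (intro prod_mono conjI coeff_bound_nonneg)
      fix j assume "j \<in> u"
      then show "coeff_bound N (y j) \<le> cell_weight N (c j) / 2 ^ snd (c j)"
        using coeff_bound_le_cell_weight[OF half[OF that, of j]] c[OF that] by simp
    qed
    also have "\<dots> = W / 2 ^ A"
      by (simp add: prod_dividef W_def A_def power_sum)
    finally have "(\<Prod>j\<in>u. coeff_bound N (y j)) \<le> W / 2 ^ A" .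
    from mult_right_mono[OF this coeff_bound_nonneg[of N "y i"]] show ?thesis
      using u by (simp add: f_def mult.commute)
  qed
  have far: "(\<Sum>y\<in>Z. f y) \<le> W / 2 ^ A * ((1 + 2 / 3 * ln X) / \<delta>)"
    if "Z \<subseteq> Y" "1 \<le> \<delta>" "real N / (2 * \<delta>) \<le> X" "1 \<le> X"
      and "\<And>y y'. y \<in> Z \<Longrightarrow> y' \<in> Z \<Longrightarrow> y \<noteq> y' \<Longrightarrow> \<delta> \<le> \<bar>real_of_int (y i - y' i)\<bar>"
      and "\<And>y. y \<in> Z \<Longrightarrow> \<delta> \<le> \<bar>real_of_int (y i)\<bar>"
    for Z \<delta> X
  proof -
    have "(\<Sum>y\<in>Z. f y) \<le> (\<Sum>y\<in>Z. W / 2 ^ A * coeff_bound N (y i))"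
      using that(1) by (intro sum_mono f_le) auto
    also have "\<dots> = W / 2 ^ A * (\<Sum>y\<in>Z. coeff_bound N (y i))"
      by (simp add: sum_distrib_left)
    also have "\<dots> \<le> W / 2 ^ A * ((1 + 2 / 3 * ln X) / \<delta>)"
    proof (rule mult_left_mono)
      show "(\<Sum>y\<in>Z. coeff_bound N (y i)) \<le> (1 + 2 / 3 * ln X) / \<delta>"
        using that N half finite_subset[OF that(1) Y(1)]
        by (intro sum_far_le[where \<phi> = "\<lambda>y. y i"]) auto
    qed (use W in simp)
    finally show ?thesis .
  qed
  define F where "F = 1 + 2 / 3 * ln (real N / 2)"
  have ln2: "0 < ln (2::real)" "ln (2::real) < 1"
    using ln_2_less_1 by auto
  show ?thesis
  proof (cases "2 ^ A < \<tau>")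
    case True
    define \<delta> where "\<delta> = \<tau> / 2 ^ A"
    have \<delta>: "1 \<le> \<delta>"
      using True by (simp add: \<delta>_def)
    have sep: "\<delta> \<le> \<bar>real_of_int (y i - y' i)\<bar>" if "y \<in> Y" "y' \<in> Y" "y \<noteq> y'" for y y'
      unfolding \<delta>_def A_def using u Y(2) _ _ that
    proof (rule separated_last_coordinate)
      show "max 1 \<bar>y j - y' j\<bar> \<le> 2 ^ snd (c j)" if "y \<in> Y" "y' \<in> Y" "j \<in> u" for y y' j
        using that c by (intro same_cell_diff) auto
    qed (use True in \<open>simp add: A_def\<close>)
    define Z where "Z = {y \<in> Y. \<delta> \<le> \<bar>real_of_int (y i)\<bar>}"
    have "(\<Sum>y\<in>Z. f y) \<le> W / 2 ^ A * ((1 + 2 / 3 * ln (real N / 2)) / \<delta>)"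
      using \<delta> sep N by (intro far) (auto simp: Z_def field_simps)
    also have "\<dots> = W * F / \<tau>"
      using \<tau> by (simp add: \<delta>_def F_def)
    finally have 1: "(\<Sum>y\<in>Z. f y) \<le> W * F / \<tau>" .
    \<comment> \<open>For near points the product bound \<open>\<tau>\<close> replaces the volume of
      the box, and \<open>cell_half\<close> in coordinate \<open>i\<close> supplies the halving off
      0.\<close>
    have 2: "(\<Sum>y\<in>Y - Z. f y) \<le> H / \<tau>"
    proof (rule sum_near_le[where \<phi> = "\<lambda>y. y i" and \<delta> = \<delta>])
      fix y assume "y \<in> Y - Z"
      then have y: "y \<in> Y" by simp
      have "f y \<le> (\<Prod>j\<in>insert i u. cell_half (dyadic_cell (y j)) / real_of_int (max 1 \<bar>y j\<bar>))"
        unfolding f_def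
        by (intro prod_mono conjI coeff_bound_nonneg coeff_bound_le_cell_half half[OF y])
      also have "\<dots> = (cell_half (dyadic_cell (y i)) * H) / (\<Prod>j\<in>insert i u. real_of_int (max 1 \<bar>y j\<bar>))"
        using u c[OF y] by (simp add: prod_dividef H_def)
      also have "\<dots> \<le> (cell_half (dyadic_cell (y i)) * H) / \<tau>"
        using Y(2) y \<tau> H cell_half_nonneg unfolding separated_def
        by (intro divide_left_mono mult_nonneg_nonneg mult_pos_pos prod_pos) auto
      also have "\<dots> = (if y i = 0 then H / \<tau> else H / \<tau> / 2)"
        by (simp add: cell_half_def)
      finally show "f y \<le> (if y i = 0 then H / \<tau> else H / \<tau> / 2)" .
    qed (use Y(1) H \<tau> sep in \<open>auto simp: Z_def\<close>)
    have "(\<Sum>y\<in>Y. f y) = (\<Sum>y\<in>Z. f y) + (\<Sum>y\<in>Y - Z. f y)"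
      using Y(1) sum.subset_diff[of Z Y f] by (simp add: Z_def)
    also have "\<dots> \<le> W * F / \<tau> + 1 * H / \<tau>"
      using 1 2 by simp
    \<comment> \<open>The factor 1 is enlarged to the constant that the other case requires.\<close>
    also have "1 * H / \<tau> \<le> (2 - 2 / 3 * ln 2) * H / \<tau>"
      using H ln2 \<tau> by (intro divide_right_mono mult_right_mono) auto
    finally show ?thesis
      by (simp add: f_def W_def H_def F_def add_divide_distrib add.commute)
  next
    case False
    \<comment> \<open>\<open>2 ^ t\<close> lies in \<open>[\<tau>/2, \<tau>)\<close>; the strict upper bound makes \<open>y i\<close> injective on subboxes.\<close>
    define t where "t = (LEAST t. \<tau> \<le> 2 ^ Suc t)"
    have "(0::real) < 2 ^ A"
      by simp
    then have "\<tau> \<le> 2 ^ Suc A"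
      using False unfolding power_Suc by linarith
    then have t1: "\<tau> \<le> 2 ^ Suc t"
      unfolding t_def by (rule LeastI)
    have t2: "2 ^ t < \<tau>"
    proof (cases t)
      case 0
      then show ?thesis using \<tau> by simp
    next
      case (Suc t')
      then have "\<not> \<tau> \<le> 2 ^ Suc t'"
        using not_less_Least[of t' "\<lambda>t. \<tau> \<le> 2 ^ Suc t"] by (simp add: t_def)
      then show ?thesis using Suc by simp
    qed
    have "(2::real) ^ t < 2 ^ A"
      using t2 False by linarith
    then have "t \<le> A"
      by (simp add: power_strict_increasing_iff)
    then obtain b where b: "\<forall>j\<in>u. b j \<le> snd (c j)" "(\<Sum>j\<in>u. b j) = t"
      using exists_bounded_sum_eq[OF u(1), of t "\<lambda>j. snd (c j)"] by (auto simp: A_def)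
    define \<delta> where "\<delta> = \<tau> / 2 ^ t"
    have \<delta>: "1 \<le> \<delta>" "\<delta> \<le> 2"
      using t1 t2 by (simp_all add: \<delta>_def field_simps)
    define X where "X = real N / (2 * \<delta>)"
    have X: "1 \<le> X"
      using N \<delta> by (simp add: X_def field_simps)
    define g where "g y = restrict (\<lambda>j. \<bar>y j\<bar> div 2 ^ b j) u" for y :: "nat \<Rightarrow> int"
    define T where "T = (\<Pi>\<^sub>E j\<in>u. subcells (c j) (b j))"
    have T: "finite T"
      unfolding T_def using u b card_subcells_le by (intro finite_PiE) auto
    have gT: "g ` Y \<subseteq> T"
      unfolding T_def g_def using c b by (auto intro!: subcell_in_subcells)
    have fibre: "(\<Sum>y\<in>{y \<in> Y. g y = p}. f y) \<le> W / 2 ^ A * (1 + (1 + 2 / 3 * ln X) / \<delta>)" for p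
    proof -
      define P where "P = {y \<in> Y. g y = p}"
      have P: "P \<subseteq> Y" "finite P"
        using Y(1) by (auto simp: P_def)
      have sep: "\<delta> \<le> \<bar>real_of_int (y i - y' i)\<bar>" if "y \<in> P" "y' \<in> P" "y \<noteq> y'" for y y'
        unfolding \<delta>_def b(2)[symmetric] using u separated_subset[OF Y(2) P(1)] _ _ that
      proof (rule separated_last_coordinate)
        show "max 1 \<bar>y j - y' j\<bar> \<le> 2 ^ b j" if "y \<in> P" "y' \<in> P" "j \<in> u" for y y' j
        proof (rule same_subcell_diff)
          show "dyadic_cell (y j) = dyadic_cell (y' j)"
            using c P that by (metis subsetD)
          have "g y j = g y' j"
            using that by (simp add: P_def)
          then show "\<bar>y j\<bar> div 2 ^ b j = \<bar>y' j\<bar> div 2 ^ b j"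
            using that by (simp add: g_def)
        qed
      qed (use t2 b(2) in simp)
      define Z where "Z = {y \<in> P. \<delta> \<le> \<bar>real_of_int (y i)\<bar>}"
      have 1: "(\<Sum>y\<in>Z. f y) \<le> W / 2 ^ A * ((1 + 2 / 3 * ln X) / \<delta>)"
        using \<delta> sep X P by (intro far) (auto simp: Z_def X_def)
      \<comment> \<open>The trivial bounds 1 and \<open>1/2\<close> in coordinate \<open>i\<close>
        suffice: over all subboxes these terms add up to at most
        \<open>W * \<delta> / \<tau>\<close>, and \<open>\<delta> \<le> 2\<close>.\<close>
      have 2: "(\<Sum>y\<in>P - Z. f y) \<le> W / 2 ^ A"
      proof (rule sum_near_le[where \<phi> = "\<lambda>y. y i" and \<delta> = \<delta>])
        fix y assume "y \<in> P - Z"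
        then have y: "y \<in> Y" using P by auto
        have "coeff_bound N (y i) \<le> (if y i = 0 then 1 else 1 / 2)"
        proof (cases "y i = 0")
          case True
          then show ?thesis by (simp add: coeff_bound_def)
        next
          case False
          then have "coeff_bound N (y i) \<le> 1 / (2 * \<bar>real_of_int (y i)\<bar>)"
            using half[OF y, of i] by (intro coeff_bound_le_half) auto
          also have "\<dots> \<le> 1 / 2"
            using False by (simp add: field_simps)
          finally show ?thesis using False by simp
        qed
        then have "W / 2 ^ A * coeff_bound N (y i) \<le> W / 2 ^ A * (if y i = 0 then 1 else 1 / 2)"
          using W by (intro mult_left_mono) auto
        then show "f y \<le> (if y i = 0 then W / 2 ^ A else W / 2 ^ A / 2)"
          using f_le[OF y] by (auto split: if_splits)
      qed (use P W sep in \<open>auto simp: Z_def\<close>)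
      have "(\<Sum>y\<in>P. f y) = (\<Sum>y\<in>Z. f y) + (\<Sum>y\<in>P - Z. f y)"
        using P sum.subset_diff[of Z P f] by (simp add: Z_def)
      then show ?thesis
        using 1 2 unfolding P_def[symmetric] by (simp add: distrib_left)
    qed
    have cardT: "real (card T) \<le> 2 ^ A / 2 ^ t"
    proof -
      have "real (card T) = (\<Prod>j\<in>u. real (card (subcells (c j) (b j))))"
        unfolding T_def using u by (simp add: card_PiE)
      also have "\<dots> \<le> (\<Prod>j\<in>u. 2 ^ snd (c j) / 2 ^ b j)"
        using b card_subcells_le by (intro prod_mono) auto
      also have "\<dots> = 2 ^ A / 2 ^ t"
        unfolding A_def b(2)[symmetric] by (simp add: prod_dividef power_sum)
      finally show ?thesis .
    qed
    \<comment> \<open>On \<open>[1, 2]\<close> the function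
      \<open>\<delta> - 2/3 * ln \<delta>\<close> is largest at \<open>\<delta> = 2\<close>, hence
      the constant \<open>2 - 2/3 * ln 2\<close>.\<close>
    have F_le: "\<delta> + (1 + 2 / 3 * ln X) \<le> (2 - 2 / 3 * ln 2) + F"
    proof -
      have "ln X = ln (real N / 2) - ln \<delta>"
        using N \<delta> by (simp add: X_def ln_div ln_mult)
      moreover have "ln (2 / \<delta>) \<le> 2 / \<delta> - 1"
        using \<delta> by (intro ln_le_minus_one) auto
      moreover have "2 / \<delta> - 1 \<le> 2 - \<delta>"
        using \<delta> mult_nonneg_nonneg[of "\<delta> - 1" "2 - \<delta>"] by (simp add: field_simps)
      moreover have "ln (2 / \<delta>) = ln 2 - ln \<delta>"
        using \<delta> by (simp add: ln_div)
      ultimately show ?thesis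
        using \<delta> unfolding F_def by argo
    qed
    have "(\<Sum>y\<in>Y. f y) = (\<Sum>p\<in>T. \<Sum>y\<in>{y \<in> Y. g y = p}. f y)"
      using sum.group[OF Y(1) T gT, of f] by simp
    also have "\<dots> \<le> real (card T) * (W / 2 ^ A * (1 + (1 + 2 / 3 * ln X) / \<delta>))"
      using fibre by (intro sum_bounded_above) auto
    also have "\<dots> \<le> 2 ^ A / 2 ^ t * (W / 2 ^ A * (1 + (1 + 2 / 3 * ln X) / \<delta>))"
      using cardT W X \<delta> by (intro mult_right_mono mult_nonneg_nonneg add_nonneg_nonneg) auto
    also have "\<dots> = W * (\<delta> + (1 + 2 / 3 * ln X)) / \<tau>"
    proof -
      define G where "G = \<delta> + (1 + 2 / 3 * ln X)"
      have "1 + (1 + 2 / 3 * ln X) / \<delta> = G / \<delta>"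
        using \<delta> by (simp add: G_def add_divide_distrib)
      then show ?thesis
        unfolding G_def[symmetric] by (simp add: \<delta>_def)
    qed
    also have "\<dots> \<le> W * ((2 - 2 / 3 * ln 2) + F) / \<tau>"
      using F_le W \<tau> by (intro divide_right_mono mult_left_mono) auto
    also have "\<dots> \<le> ((2 - 2 / 3 * ln 2) * H + W * F) / \<tau>"
      using mult_left_mono[OF WH, of "2 - 2 / 3 * ln 2"] ln2 \<tau>
      by (intro divide_right_mono) (simp_all add: distrib_left mult.commute)
    finally show ?thesis
      by (simp add: f_def W_def H_def F_def)
  qed
qed

section \<open>Numerical estimates\<close>

lemma ln_2_ge: "69 / 100 \<le> ln (2::real)"
  using ln_approx_bounds[of 2 2] by (simp add: eval_nat_numeral)

lemma two_powr_le_1_plus: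
  fixes x :: real
  assumes "0 \<le> x" "x \<le> 1"
  shows "2 powr x \<le> 1 + x"
  using convex_onD[OF exp_convex, of x 0 "ln 2"] assms
  by (simp add: powr_def)

text \<open>Chords of the convex function bound it by \<open>2 * t\<close> on \<open>[1, 2]\<close>
  and by \<open>4 * t - 4\<close> on \<open>[2, 3]\<close>.\<close>

lemma two_powr_le_3_times:
  fixes t :: real
  assumes "1 \<le> t" "t \<le> 3"
  shows "2 powr t \<le> 3 * t"
proof (cases "t \<le> 2")
  case True
  have "2 powr t = 2 * 2 powr (t - 1)"
    by (simp add: powr_diff)
  then show ?thesis
    using two_powr_le_1_plus[of "t - 1"] True assms by simp
next
  case False
  have "2 powr t = 4 * 2 powr (t - 2)"
    by (simp add: powr_diff)
  then show ?thesis
    using two_powr_le_1_plus[of "t - 2"] False assms by simp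
qed

text \<open>Contrapositive of the case in which the bound exceeds 1, using \<open>\<tau> \<le> N = 2 powr L\<close>.\<close>

lemma log_ge_of_bound_less:
  fixes L :: real
  assumes "n \<ge> 1" "L \<ge> 1"
    and less: "ln 2 * L ^ Suc n + 3 * (2 * L) ^ n < 2 * 2 powr L"
  shows "3 * real n \<le> L" "n = 1 \<Longrightarrow> 4 \<le> L"
proof -
  have pos: "0 \<le> ln 2 * L ^ Suc n"
    using assms by simp
  show "3 * real n \<le> L"
  proof (rule ccontr)
    assume *: "\<not> 3 * real n \<le> L"
    have "2 * 2 powr L \<le> 3 * (2 * L) ^ n"
    proof (cases "n = 1")
      case True
      then show ?thesis
        using two_powr_le_3_times[of L] * assms by simp
    next
      case False
      \<comment> \<open>Taking \<open>n\<close>-th roots, it is enough that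
        \<open>2 powr t \<le> 2 * L\<close>; for \<open>1 < t\<close> this follows from
        \<open>2 powr t \<le> 3 * t\<close> and \<open>n \<ge> 2\<close>.\<close>
      define t where "t = L / real n"
      have "2 powr t \<le> 2 * L"
      proof (cases "t \<le> 1")
        case True
        then have "2 powr t \<le> 2 powr 1"
          by (intro powr_mono) auto
        then show ?thesis
          using assms by simp
      next
        case t: False
        then have "2 powr t \<le> 3 * t"
          using * assms by (intro two_powr_le_3_times) (auto simp: t_def field_simps)
        also have "\<dots> \<le> 2 * (real n * t)"
          using mult_right_mono[of 2 "real n" t] False assms(1) t by linarith
        finally show ?thesis
          using assms by (simp add: t_def)
      qed
      then have "(2 powr t) ^ n \<le> (2 * L) ^ n"
        by (intro power_mono) auto
      moreover have "(2 powr t) ^ n = 2 powr L"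
        using assms by (simp add: powr_power t_def)
      moreover have "0 \<le> (2 * L) ^ n"
        using assms by simp
      ultimately show ?thesis by linarith
    qed
    then show False
      using less pos by linarith
  qed
  assume n: "n = 1"
  show "4 \<le> L"
  proof (rule ccontr)
    assume *: "\<not> 4 \<le> L"
    have L: "3 \<le> L"
      using \<open>3 * real n \<le> L\<close> n by simp
    have "2 powr L = 8 * 2 powr (L - 3)"
      by (simp add: powr_diff)
    then have "2 powr L \<le> 8 * (1 + (L - 3))"
      using two_powr_le_1_plus[of "L - 3"] L * by simp
    \<comment> \<open>The chord bounds \<open>2 * 2 powr L\<close> by \<open>16 * L - 32\<close>.
      This product, non-negative for \<open>3 \<le> L < 4\<close>, shows that it is at most
      \<open>ln 2 * L^2 + 6 * L\<close>.\<close>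
    moreover have "0 \<le> (4 - L) * (10 - 69 / 100 * (4 + L))"
      using * L by (intro mult_nonneg_nonneg) auto
    then have "16 * L - 32 \<le> 69 / 100 * (L * L) + 6 * L"
      by (simp add: field_simps)
    moreover have "69 / 100 * (L * L) \<le> ln 2 * (L * L)"
      using ln_2_ge by (intro mult_right_mono) auto
    ultimately show False
      using less by (simp add: n)
  qed
qed

text \<open>The leading coefficients in \<open>L\<close> compare as
  \<open>(2/3)^(n+1) * ln 2\<close> against \<open>ln 2 / 2\<close>; the lower bounds on
  \<open>L\<close> make the remaining terms fit.\<close>

lemma box_sum_le_bound:
  fixes L l :: real
  assumes n: "n \<ge> 1" and L: "3 * real n \<le> L" "n = 1 \<Longrightarrow> 4 \<le> L" and l: "0 \<le> l" "l \<le> L"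
  shows "(2 - 2 / 3 * ln 2) * (1 + l) ^ n + (13 / 9 + 2 / 3 * l) ^ n * (1 + 2 / 3 * ((L - 1) * ln 2))
    \<le> (ln 2 * L ^ Suc n + 3 * (2 * L) ^ n) / 2"
proof -
  define c :: real where "c = ln 2"
  have c: "69 / 100 \<le> c" "c \<le> 1"
    using ln_2_ge ln_2_less_1 by (simp_all add: c_def)
  define S where "S = 13 / 9 + 2 / 3 * L"
  define F where "F = 1 + 2 / 3 * ((L - 1) * c)"
  have "3 \<le> 3 * real n"
    using n by simp
  then have L3: "3 \<le> L"
    using L(1) by linarith
  then have F: "0 \<le> F"
    using c by (simp add: F_def)
  have "(2 - 2 / 3 * c) * (1 + l) ^ n + (13 / 9 + 2 / 3 * l) ^ n * F
      \<le> (2 - 2 / 3 * c) * (1 + L) ^ n + S ^ n * F"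
    using l F c unfolding S_def
    by (intro add_mono mult_left_mono mult_right_mono power_mono) auto
  also have "\<dots> \<le> (c * L ^ Suc n + 3 * (2 * L) ^ n) / 2"
  proof (cases "n = 1")
    case True
    then have "4 \<le> L" using L by simp
    have "16 * (c / 18) \<le> L * L * (c / 18)"
      using \<open>4 \<le> L\<close> c mult_mono[of 4 L 4 L] by (intro mult_right_mono) auto
    moreover have "4 * (1 / 3 + 4 / 27 * c) \<le> L * (1 / 3 + 4 / 27 * c)"
      using \<open>4 \<le> L\<close> c by (intro mult_right_mono) auto
    \<comment> \<open>The value at \<open>L = 4\<close> of the quadratic below; it is positive by a
      small margin only, for which \<open>ln 2 \<ge> 69/100\<close> is enough.\<close>
    moreover have "0 \<le> 16 * (c / 18) + 4 * (1 / 3 + 4 / 27 * c) - 31 / 9 + 44 / 27 * c"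
      using c by simp
    ultimately have "0 \<le> L * L * (c / 18) + L * (1 / 3 + 4 / 27 * c) - 31 / 9 + 44 / 27 * c"
      by argo
    also have "\<dots> = (c * L ^ 2 + 3 * (2 * L)) / 2 - ((2 - 2 / 3 * c) * (1 + L) + S * F)"
      by (simp add: S_def F_def field_simps power2_eq_square)
    finally show ?thesis
      using True by (simp add: power2_eq_square)
  next
    case False
    then have n2: "2 \<le> n" using n by simp
    then have "6 \<le> 3 * real n" by simp
    then have L6: "6 \<le> L" using L by linarith
    have "(1 + L) ^ n \<le> 3 / 2 * L ^ n"
    proof -
      have eq: "1 + (- 1 / (1 + L)) = L / (1 + L)"
        using L6 by (simp add: field_simps)
      \<comment> \<open>Bernoulli's inequality and \<open>L \<ge> 3 * n\<close> bound
        \<open>(L / (1 + L)) ^ n\<close> below by \<open>2/3\<close>.\<close>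
      have "1 + real n * (- 1 / (1 + L)) \<le> (L / (1 + L)) ^ n"
        unfolding eq[symmetric] using L6 by (intro Bernoulli_inequality) (simp add: field_simps)
      moreover have "2 / 3 \<le> 1 + real n * (- 1 / (1 + L))"
        using L L6 by (simp add: field_simps)
      ultimately have "2 / 3 \<le> L ^ n / (1 + L) ^ n"
        unfolding power_divide by linarith
      then show ?thesis
        using L6 by (simp add: field_simps)
    qed
    then have 1: "(2 - 2 / 3 * c) * (1 + L) ^ n \<le> (2 - 2 / 3 * c) * (3 / 2 * L ^ n)"
      using c by (intro mult_left_mono) auto
    have n_eq: "n - 2 + 2 = n" "n - 2 + 3 = Suc n"
      using n2 by simp_all
    \<comment> \<open>Two factors \<open>S\<close> are kept and the others bounded by
      \<open>L\<close>, which reduces the claim to a cubic inequality in \<open>L\<close>.\<close>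
    have "S ^ n = S ^ (n - 2) * S ^ 2"
      by (simp only: power_add[symmetric] n_eq)
    also have "\<dots> \<le> L ^ (n - 2) * S ^ 2"
      using L6 by (intro mult_right_mono power_mono) (auto simp: S_def)
    finally have "S ^ n * F \<le> L ^ (n - 2) * S ^ 2 * F"
      using F by (intro mult_right_mono)
    also have "\<dots> = L ^ (n - 2) * (S ^ 2 * F)"
      by simp
    also have "S ^ 2 * F \<le> c * L ^ 3 / 2 + (3 + c) * L ^ 2"
    proof -
      have "0 \<le> c * (L * (L * L))" "0 \<le> c * (L * L)" "c * L \<le> 1 * L" "6 * L \<le> L * L" "0 \<le> c * L"
        using c L6 by (auto intro: mult_right_mono)
      then have "0 \<le> c * (L * (L * L)) * (11 / 54) + L * L * (23 / 9) + c * (L * L) * (1 / 81)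
          - L * (52 / 27) - c * L * (26 / 243) - 169 / 81 + 338 / 243 * c"
        using c L6 by linarith
      also have "\<dots> = c * L ^ 3 / 2 + (3 + c) * L ^ 2 - S ^ 2 * F"
        by (simp add: S_def F_def field_simps power2_eq_square power3_eq_cube)
      finally show ?thesis by simp
    qed
    then have "L ^ (n - 2) * (S ^ 2 * F) \<le> L ^ (n - 2) * (c * L ^ 3 / 2 + (3 + c) * L ^ 2)"
      using L6 by (intro mult_left_mono) auto
    also have "\<dots> = c * (L ^ (n - 2) * L ^ 3) / 2 + (3 + c) * (L ^ (n - 2) * L ^ 2)"
      by (simp add: algebra_simps)
    also have "L ^ (n - 2) * L ^ 3 = L ^ Suc n"
      by (simp only: power_add[symmetric] n_eq)
    also have "L ^ (n - 2) * L ^ 2 = L ^ n"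
      by (simp only: power_add[symmetric] n_eq)
    finally have 2: "S ^ n * F \<le> c * L ^ Suc n / 2 + (3 + c) * L ^ n" .
    \<comment> \<open>The terms \<open>(3 - c) * L ^ n\<close> and \<open>(3 + c) * L ^ n\<close>
      add up to \<open>6 * L ^ n\<close>, and \<open>4 \<le> 2 ^ n\<close> makes this at most
      \<open>3 * (2 * L) ^ n / 2\<close>.\<close>
    have "(2::real) ^ 2 \<le> 2 ^ n"
      using n2 by (intro power_increasing) auto
    then have "4 * L ^ n \<le> 2 ^ n * L ^ n"
      using L6 by (intro mult_right_mono) auto
    then have "4 * L ^ n \<le> (2 * L) ^ n"
      by (simp add: power_mult_distrib)
    then show ?thesis
      using 1 2 by (simp add: algebra_simps)
  qed
  finally show ?thesis
    by (simp add: c_def F_def)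
qed

section \<open>The star discrepancy of lattice points\<close>

definition long_dual :: "nat \<Rightarrow> (nat \<Rightarrow> nat) \<Rightarrow> nat set \<Rightarrow> real \<Rightarrow> bool" where
  "long_dual N z u \<tau> \<longleftrightarrow>
    (\<forall>d. (\<exists>j\<in>u. d j \<noteq> 0) \<longrightarrow> int N dvd (\<Sum>j\<in>u. d j * int (z j)) \<longrightarrow>
      \<tau> \<le> (\<Prod>j\<in>u. real_of_int (max 1 \<bar>d j\<bar>)))"

text \<open>Tests the condition on a vector with the single non-zero entry \<open>m\<close>; used
  with \<open>m = N\<close>, which gives \<open>\<tau> \<le> N\<close>, and with
  \<open>m = N div gcd (z i) N\<close>.\<close>

lemma long_dual_single:
  assumes "long_dual N z u \<tau>" "finite u" "i \<in> u" "m > 0" "int N dvd int m * int (z i)"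
  shows "\<tau> \<le> real m"
proof -
  define d where "d j = (if j = i then int m else 0)" for j
  have "(\<Sum>j\<in>u. d j * int (z j)) = (\<Sum>j\<in>u. if j = i then int m * int (z i) else 0)"
    by (intro sum.cong) (auto simp: d_def)
  then have "int N dvd (\<Sum>j\<in>u. d j * int (z j))"
    using assms by simp
  moreover have "\<exists>j\<in>u. d j \<noteq> 0"
    using assms(3,4) by (auto simp: d_def)
  ultimately have "\<tau> \<le> (\<Prod>j\<in>u. real_of_int (max 1 \<bar>d j\<bar>))"
    using assms(1) by (auto simp: long_dual_def)
  also have "\<dots> = (\<Prod>j\<in>u. if j = i then real m else 1)"
    using assms(4) by (intro prod.cong) (auto simp: d_def max_def)
  also have "\<dots> = real m"
    using assms(2,3) by simp
  finally show ?thesis .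
qed

lemma separated_nonzero_dual_residues:
  assumes "long_dual N z u \<tau>"
  shows "separated u \<tau> (nonzero_dual_residues N z u)"
  unfolding separated_def
proof (intro conjI ballI impI)
  fix y assume "y \<in> nonzero_dual_residues N z u"
  then show "\<tau> \<le> (\<Prod>j\<in>u. real_of_int (max 1 \<bar>y j\<bar>))"
    using assms by (auto simp: long_dual_def nonzero_dual_residues_def)
next
  fix y y' assume y: "y \<in> nonzero_dual_residues N z u" "y' \<in> nonzero_dual_residues N z u" "y \<noteq> y'"
  have "\<exists>j\<in>u. y j - y' j \<noteq> 0"
  proof (rule ccontr)
    assume "\<not> ?thesis"
    then have "y = y'"
      using y by (intro PiE_ext[of y u "\<lambda>_. residues_abs_le_half N" y'])
        (auto simp: nonzero_dual_residues_def)
    then show False using y(3) by simp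
  qed
  moreover have "int N dvd (\<Sum>j\<in>u. (y j - y' j) * int (z j))"
  proof -
    have "int N dvd (\<Sum>j\<in>u. y j * int (z j))" "int N dvd (\<Sum>j\<in>u. y' j * int (z j))"
      using y by (simp_all add: nonzero_dual_residues_def)
    then show ?thesis
      unfolding left_diff_distrib sum_subtractf by (rule dvd_diff)
  qed
  ultimately show "\<tau> \<le> (\<Prod>j\<in>u. real_of_int (max 1 \<bar>y j - y' j\<bar>))"
    using assms[unfolded long_dual_def, rule_format, of "\<lambda>j. y j - y' j"] by simp
qed

text \<open>A box is a product of cells over the coordinates in \<open>u\<close>, so the sum of the
  box estimate over all boxes factorises into powers of one-dimensional cell sums.\<close>

lemma dual_sum_le:
  assumes u: "finite u" "i \<notin> u" and N: "N \<ge> 4" and \<tau>: "1 < \<tau>" "long_dual N z (insert i u) \<tau>"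
  defines "l \<equiv> real (dyadic_level (int N))"
  shows "(\<Sum>k\<in>nonzero_dual_residues N z (insert i u). \<Prod>j\<in>insert i u. coeff_bound N (k j)) \<le>
    ((2 - 2 / 3 * ln 2) * (1 + l) ^ card u
      + (13 / 9 + 2 / 3 * l) ^ card u * (1 + 2 / 3 * ln (real N / 2))) / \<tau>"
proof -
  define Y where "Y = nonzero_dual_residues N z (insert i u)"
  define Cs where "Cs = dyadic_cells (dyadic_level (int N))"
  define f where "f k = (\<Prod>j\<in>insert i u. coeff_bound N (k j))" for k
  define g where "g k = restrict (\<lambda>j. dyadic_cell (k j)) u" for k :: "nat \<Rightarrow> int"
  define F where "F = 1 + 2 / 3 * ln (real N / 2)"
  define \<Phi> :: real where "\<Phi> = 2 - 2 / 3 * ln 2"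
  have F: "0 \<le> F"
    using N by (simp add: F_def)
  have \<Phi>: "0 \<le> \<Phi>"
    using ln_2_less_1 by (simp add: \<Phi>_def)
  have Y: "finite Y"
    using u by (simp add: Y_def finite_nonzero_dual_residues)
  have half: "2 * \<bar>y j\<bar> \<le> int N" if y: "y \<in> Y" and j: "j \<in> insert i u" for y j
  proof -
    have "y \<in> (\<Pi>\<^sub>E j\<in>insert i u. residues_abs_le_half N)"
      using y by (simp add: Y_def nonzero_dual_residues_def)
    from PiE_mem[OF this j] show ?thesis
      by (auto simp: residues_abs_le_half_def)
  qed
  have finC: "finite (\<Pi>\<^sub>E j\<in>u. Cs)"
    using u finite_dyadic_cells by (intro finite_PiE) (auto simp: Cs_def)
  have gC: "g ` Y \<subseteq> (\<Pi>\<^sub>E j\<in>u. Cs)"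
    using half N by (auto simp: g_def Cs_def intro!: dyadic_cell_in_cells)
  have fibre: "(\<Sum>k\<in>{k \<in> Y. g k = c}. f k)
      \<le> (\<Phi> * (\<Prod>j\<in>u. cell_half (c j)) + (\<Prod>j\<in>u. cell_weight N (c j)) * F) / \<tau>"
    if c: "c \<in> (\<Pi>\<^sub>E j\<in>u. Cs)" for c
    unfolding f_def \<Phi>_def F_def using u N \<tau>(1)
  proof (rule box_sum_le)
    show "separated (insert i u) \<tau> {k \<in> Y. g k = c}"
      using separated_nonzero_dual_residues[OF \<tau>(2)]
      by (rule separated_subset) (auto simp: Y_def)
    show "dyadic_cell (y j) = c j" if "y \<in> {k \<in> Y. g k = c}" "j \<in> u" for y j
      using that by (auto simp: g_def)
    show "c j \<in> dyadic_cells (dyadic_level (int N))" if "j \<in> u" for j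
      using PiE_mem[OF c that] by (simp add: Cs_def)
  qed (use Y half in auto)
  have "(\<Sum>k\<in>Y. f k) = (\<Sum>c\<in>(\<Pi>\<^sub>E j\<in>u. Cs). \<Sum>k\<in>{k \<in> Y. g k = c}. f k)"
    using sum.group[OF Y finC gC, of f] by simp
  also have "\<dots> \<le> (\<Sum>c\<in>(\<Pi>\<^sub>E j\<in>u. Cs).
      (\<Phi> * (\<Prod>j\<in>u. cell_half (c j)) + (\<Prod>j\<in>u. cell_weight N (c j)) * F) / \<tau>)"
    using fibre by (rule sum_mono)
  also have "\<dots> = (\<Phi> * (\<Sum>c\<in>(\<Pi>\<^sub>E j\<in>u. Cs). \<Prod>j\<in>u. cell_half (c j))
      + (\<Sum>c\<in>(\<Pi>\<^sub>E j\<in>u. Cs). \<Prod>j\<in>u. cell_weight N (c j)) * F) / \<tau>"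
    by (simp add: sum_divide_distrib[symmetric] sum.distrib sum_distrib_left sum_distrib_right)
  also have "(\<Sum>c\<in>(\<Pi>\<^sub>E j\<in>u. Cs). \<Prod>j\<in>u. cell_half (c j)) = (\<Sum>c\<in>Cs. cell_half c) ^ card u"
    using u finite_dyadic_cells by (subst prod_sum_PiE[symmetric]) (auto simp: Cs_def)
  also have "(\<Sum>c\<in>(\<Pi>\<^sub>E j\<in>u. Cs). \<Prod>j\<in>u. cell_weight N (c j)) = (\<Sum>c\<in>Cs. cell_weight N c) ^ card u"
    using u finite_dyadic_cells by (subst prod_sum_PiE[symmetric]) (auto simp: Cs_def)
  also have "(\<Sum>c\<in>Cs. cell_half c) = 1 + l"
    by (simp add: Cs_def sum_cell_half l_def)
  also have "(\<Phi> * (1 + l) ^ card u + (\<Sum>c\<in>Cs. cell_weight N c) ^ card u * F) / \<tau>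
      \<le> (\<Phi> * (1 + l) ^ card u + (13 / 9 + 2 / 3 * l) ^ card u * F) / \<tau>"
    using sum_cell_weight_le[of N] N \<tau>(1) F unfolding Cs_def l_def
    by (intro divide_right_mono add_left_mono mult_right_mono power_mono sum_nonneg cell_weight_nonneg) auto
  finally show ?thesis
    by (simp add: Y_def f_def F_def \<Phi>_def)
qed

text \<open>For several coordinates, \<open>\<tau> \<le> N\<close> turns
  \<open>B < 2 * \<tau>\<close> into the lower bounds on \<open>log 2 N\<close> under which the
  numerical estimate holds. For one coordinate the direct count gives \<open>1 / \<tau>\<close>, and
  \<open>B \<ge> 3\<close>.\<close>

lemma lattice_count_error_le:
  fixes \<tau> :: real
  assumes u: "finite u" "u \<noteq> {}" and N: "N \<ge> 2" and M: "\<And>j. j \<in> u \<Longrightarrow> M j \<le> N"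
    and long: "long_dual N z u \<tau>"
  defines "B \<equiv> ln 2 * log 2 (real N) ^ card u + 3 * (2 * log 2 (real N)) ^ (card u - 1)"
  assumes B: "B < 2 * \<tau>"
  shows "\<bar>lattice_count N z u M / real N - (\<Prod>j\<in>u. real (M j) / real N)\<bar> \<le> B / (2 * \<tau>)"
proof -
  define L where "L = log 2 (real N)"
  have L: "1 \<le> L"
    using N by (simp add: L_def le_log_iff)
  obtain i where i: "i \<in> u"
    using u by blast
  define n where "n = card (u - {i})"
  have card_u: "card u = Suc n"
    unfolding n_def using u i by (metis card_Suc_Diff1)
  have B_eq: "B = ln 2 * L ^ Suc n + 3 * (2 * L) ^ n"
    by (simp add: B_def card_u L_def)
  have "1 \<le> (2 * L) ^ n"
    using L by (intro one_le_power) simp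
  moreover have "0 \<le> ln 2 * L ^ Suc n"
    using L by (intro mult_nonneg_nonneg zero_le_power) auto
  ultimately have B3: "3 \<le> B"
    unfolding B_eq by linarith
  then have \<tau>1: "1 < \<tau>"
    using B by linarith
  show ?thesis
  proof (cases "n = 0")
    case True
    then have u_eq: "u = {i}"
      using card_u i by (metis One_nat_def card_1_singletonE singletonD)
    define g where "g = gcd (z i) N"
    define q where "q = N div g"
    have Nq: "N = g * q" and g: "g > 0"
      using N by (simp_all add: g_def q_def)
    have q: "q > 0"
      using Nq N by (cases q) auto
    have "N dvd q * z i"
      using Nq by (metis dvd_def g_def gcd_dvd1 mult.commute mult_dvd_mono dvd_refl)
    then have "int N dvd int q * int (z i)"
      by (metis of_nat_dvd_iff of_nat_mult)
    then have "\<tau> \<le> real q"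
      using long_dual_single[OF long u(1) i q] by simp
    have "\<bar>lattice_count N z u M / real N - (\<Prod>j\<in>u. real (M j) / real N)\<bar> \<le> real g / real N"
      using lattice_count_singleton_error[of N M i z] N M[OF i] by (simp add: u_eq g_def)
    also have "\<dots> = 1 / real q"
      using g by (simp add: Nq)
    also have "\<dots> \<le> 1 / \<tau>"
      using \<open>\<tau> \<le> real q\<close> \<tau>1 by (intro divide_left_mono) auto
    also have "\<dots> \<le> B / (2 * \<tau>)"
      using B3 \<tau>1 by (simp add: field_simps)
    finally show ?thesis .
  next
    case False
    have "\<tau> \<le> real N"
      using long_dual_single[OF long u(1) i, of N] N by simp
    moreover have "2 powr L = real N"
      using N by (simp add: L_def)
    ultimately have "B < 2 * 2 powr L"
      using B by simp
    then have Ln: "3 * real n \<le> L" "n = 1 \<Longrightarrow> 4 \<le> L"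
      using log_ge_of_bound_less[of n L] False L by (auto simp: B_eq)
    have "1 \<le> real n"
      using False by simp
    then have "2 \<le> L"
      using Ln(1) by linarith
    then have "2 powr 2 \<le> 2 powr L"
      by (intro powr_mono) auto
    then have N4: "N \<ge> 4"
      using \<open>2 powr L = real N\<close> by simp
    define l where "l = real (dyadic_level (int N))"
    have l: "0 \<le> l" "l \<le> L"
      using L by (auto simp: l_def dyadic_level_def L_def[symmetric] of_nat_floor)
    have ln_eq: "ln (real N / 2) = (L - 1) * ln 2"
      using N by (simp add: L_def log_def ln_div field_simps)
    have u_eq: "insert i (u - {i}) = u"
      using i by blast
    have "\<bar>lattice_count N z u M / real N - (\<Prod>j\<in>u. real (M j) / real N)\<bar>
        \<le> (\<Sum>k\<in>nonzero_dual_residues N z u. \<Prod>j\<in>u. coeff_bound N (k j))"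
      using u N M by (intro lattice_count_error_le_sum) auto
    also have "\<dots> \<le> ((2 - 2 / 3 * ln 2) * (1 + l) ^ n
        + (13 / 9 + 2 / 3 * l) ^ n * (1 + 2 / 3 * ((L - 1) * ln 2))) / \<tau>"
      using dual_sum_le[of "u - {i}" i N \<tau> z] u N4 \<tau>1 long
      unfolding u_eq n_def[symmetric] l_def[symmetric] ln_eq by simp
    also have "\<dots> \<le> B / 2 / \<tau>"
      unfolding B_eq using box_sum_le_bound[OF _ Ln l] False \<tau>1 by (intro divide_right_mono) auto
    finally show ?thesis
      by simp
  qed
qed

section \<open>Passing from discrete boxes to arbitrary boxes\<close>

lemma prod_diff_le:
  fixes a b :: "'a \<Rightarrow> real"
  assumes "finite u" "0 \<le> h" "h \<le> 1"
    and ab: "\<And>j. j \<in> u \<Longrightarrow> 0 \<le> a j \<and> a j \<le> b j \<and> b j \<le> 1 \<and> b j \<le> a j + h"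
  shows "(\<Prod>j\<in>u. b j) - (\<Prod>j\<in>u. a j) \<le> 1 - (1 - h) ^ card u"
  using assms(1) ab
proof (induction u rule: finite_induct)
  case empty
  then show ?case by simp
next
  case (insert i u)
  define A where "A = (\<Prod>j\<in>u. a j)"
  define C where "C = (\<Prod>j\<in>u. b j)"
  define q where "q = (1 - h) ^ card u"
  define e where "e = b i - a i"
  have i: "0 \<le> a i" "a i \<le> 1 - e" "0 \<le> e" "e \<le> h"
    using insert.prems[of i] by (auto simp: e_def)
  have IH: "C - A \<le> 1 - q"
    using insert by (simp add: A_def C_def q_def)
  have C: "0 \<le> C" "C \<le> 1"
    using insert.prems unfolding C_def by (fastforce intro!: prod_nonneg prod_le_1)+
  have q: "0 \<le> q" "q \<le> 1"
    using assms(2,3) by (auto simp: q_def power_le_one)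
  \<comment> \<open>Splitting off one factor. The extremal case is \<open>b j = 1\<close>,
    \<open>a j = 1 - h\<close>, where equality holds in every estimate.\<close>
  have "b i * C - a i * A = a i * (C - A) + e * C"
    by (simp add: e_def algebra_simps)
  also have "\<dots> \<le> (1 - e) * (1 - q) + e * 1"
  proof (intro add_mono mult_left_mono)
    have "a i * (C - A) \<le> a i * (1 - q)"
      using IH i by (intro mult_left_mono)
    also have "\<dots> \<le> (1 - e) * (1 - q)"
      using i q by (intro mult_right_mono) auto
    finally show "a i * (C - A) \<le> (1 - e) * (1 - q)" .
  qed (use i C in auto)
  also have "\<dots> = 1 - q + e * q"
    by (simp add: algebra_simps)
  also have "\<dots> \<le> 1 - q + h * q"
    using i q by (intro add_left_mono mult_right_mono)
  also have "\<dots> = 1 - (1 - h) ^ card (insert i u)"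
    using insert.hyps by (simp add: q_def algebra_simps)
  finally show ?case
    using insert.hyps by (simp add: A_def C_def)
qed

lemma frac_of_nat_divide:
  assumes "N > 0"
  shows "frac (real a / real N) = real (a mod N) / real N"
proof -
  have "real a = real (a div N) * real N + real (a mod N)"
    by (metis div_mult_mod_eq of_nat_add of_nat_mult)
  then have "real a / real N = real_of_int (int (a div N)) + real (a mod N) / real N"
    using assms by (simp add: field_simps)
  moreover have "0 \<le> real (a mod N) / real N" "real (a mod N) / real N < 1"
    using assms by (auto simp: field_simps)
  ultimately show ?thesis
    by (simp only: frac_eq frac_def floor_add_int[symmetric]) (simp add: floor_eq_iff)
qed

text \<open>Rounding \<open>N * y j\<close> up to an integer leaves the count unchanged, because the
  coordinates of the points are multiples of \<open>1/N\<close>; only the volume grows.\<close>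

lemma local_discrepancy_lattice_le:
  assumes u: "finite u" "u \<noteq> {}" and N: "N \<ge> 2" and long: "long_dual N z u \<tau>"
    and y: "y \<in> (\<Pi>\<^sub>E j\<in>u. {0..<1})"
  defines "B \<equiv> ln 2 * log 2 (real N) ^ card u + 3 * (2 * log 2 (real N)) ^ (card u - 1)"
  assumes B: "B < 2 * \<tau>"
  shows "\<bar>local_discrepancy N (projection u (lattice_points N z)) u y\<bar>
    \<le> 1 - (1 - 1 / real N) ^ card u + B / (2 * \<tau>)"
proof -
  define M where "M j = nat \<lceil>real N * y j\<rceil>" for j
  have yj: "0 \<le> y j" "y j < 1" if "j \<in> u" for j
    using PiE_mem[OF y that] by auto
  have My: "real N * y j \<le> real (M j)" "real (M j) < real N * y j + 1" if "j \<in> u" for j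
    using yj[OF that] ceiling_correct[of "real N * y j"] unfolding M_def by (auto simp: of_nat_nat)
  have MN: "M j \<le> N" if "j \<in> u" for j
  proof -
    have "real N * y j \<le> real N * 1"
      using yj[OF that] by (intro mult_left_mono) auto
    then show ?thesis
      unfolding M_def by (simp add: ceiling_le_iff nat_le_iff)
  qed
  have mem: "lattice_points N z n j \<in> {0..<y j} \<longleftrightarrow> n * z j mod N < M j" if "j \<in> u" for n j
  proof -
    have eq: "lattice_points N z n j = real (n * z j mod N) / real N"
      using frac_of_nat_divide[of N "n * z j"] N by (simp add: lattice_points_def)
    have "lattice_points N z n j \<in> {0..<y j} \<longleftrightarrow> real (n * z j mod N) < real N * y j"
      unfolding eq using N by (simp add: pos_divide_less_eq mult.commute)
    also have "\<dots> \<longleftrightarrow> n * z j mod N < M j"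
      unfolding M_def by (simp add: less_ceiling_iff zless_nat_eq_int_zless)
    finally show ?thesis .
  qed
  have "indicator (\<Pi>\<^sub>E j\<in>u. {0..<y j}) (projection u (lattice_points N z) n)
      = (of_bool (\<forall>j\<in>u. n * z j mod N < M j) :: real)" for n
    using mem by (simp add: indicator_def projection_def PiE_iff Pi_iff)
  then have disc: "local_discrepancy N (projection u (lattice_points N z)) u y
      = lattice_count N z u M / real N - (\<Prod>j\<in>u. y j)"
    by (simp add: local_discrepancy_def lattice_count_def)
  have step: "y j \<le> real (M j) / real N" "real (M j) / real N \<le> y j + 1 / real N"
      "real (M j) / real N \<le> 1" if "j \<in> u" for j
    using My[OF that] MN[OF that] N by (simp_all add: field_simps)
  have 1: "(\<Prod>j\<in>u. real (M j) / real N) - (\<Prod>j\<in>u. y j) \<le> 1 - (1 - 1 / real N) ^ card u"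
    using u N yj step by (intro prod_diff_le) auto
  have 2: "(\<Prod>j\<in>u. y j) \<le> (\<Prod>j\<in>u. real (M j) / real N)"
    using yj step by (intro prod_mono) auto
  have 3: "\<bar>lattice_count N z u M / real N - (\<Prod>j\<in>u. real (M j) / real N)\<bar> \<le> B / (2 * \<tau>)"
    using u N MN long B unfolding B_def by (intro lattice_count_error_le) auto
  show ?thesis
    unfolding disc using 1 2 3 by linarith
qed

section \<open>From \<open>rho\<close> to the length of dual vectors\<close>

lemma dual_prod_ge:
  assumes N: "N \<ge> 1" and \<alpha>: "\<alpha> > 0" and u: "u \<in> nonempty_subsets s" and \<gamma>u: "\<gamma> u > 0"
    and nonneg: "\<And>v. v \<in> nonempty_subsets s \<Longrightarrow> 0 \<le> \<gamma> v"
    and mono: "\<And>v. v \<noteq> {} \<Longrightarrow> v \<subseteq> u \<Longrightarrow> \<gamma> u \<le> \<gamma> v"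
  shows "rho \<alpha> \<gamma> s N z > 0"
    and "long_dual N z u (\<gamma> u powr (1 / (2 * \<alpha>)) / rho \<alpha> \<gamma> s N z powr (1 / (2 * \<alpha>)))"
proof -
  define R where "R = rho \<alpha> \<gamma> s N z"
  have fin: "finite v" if "v \<in> nonempty_subsets s" for v
    using that finite_subset by (auto simp: nonempty_subsets_def)
  have finS: "finite (nonempty_subsets s)"
    by (simp add: nonempty_subsets_def)
  have decay_le: "decay \<alpha> \<gamma> v k \<le> R" if v: "v \<in> nonempty_subsets s" and k: "k \<in> dual_lattice N z v" for v k
  proof -
    \<comment> \<open>This bound makes the supremum in \<open>rho\<close> an upper bound of its
      members.\<close>
    have "decay \<alpha> \<gamma> v k' \<le> \<gamma> v" if "k' \<in> dual_lattice N z v" for k'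
    proof -
      have "1 \<le> \<bar>real_of_int (k' j)\<bar>" if "j \<in> v" for j
      proof -
        have "k' j \<noteq> 0"
          using \<open>k' \<in> _\<close> that by (auto simp: dual_lattice_def)
        then have "1 \<le> \<bar>k' j\<bar>"
          by simp
        then show ?thesis
          by (metis of_int_1_le_iff of_int_abs)
      qed
      then have "(\<Prod>j\<in>v. real_of_int \<bar>k' j\<bar> powr (- 2 * \<alpha>)) \<le> 1"
        using \<alpha> by (intro prod_le_1 conjI) (auto simp: powr_minus inverse_le_1_iff intro!: ge_one_powr_ge_zero)
      then show ?thesis
        using mult_left_mono[OF _ nonneg[OF v], of _ 1] by (simp add: decay_def)
    qed
    then have "decay \<alpha> \<gamma> v k \<le> (SUP k\<in>dual_lattice N z v. decay \<alpha> \<gamma> v k)"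
      using k by (intro cSUP_upper bdd_aboveI2)
    also have "\<dots> \<le> R"
      unfolding R_def rho_def using v finS by (intro Max_ge) auto
    finally show ?thesis .
  qed
  obtain k where k: "k \<in> dual_lattice N z u"
    using dual_lattice_nonempty[OF N] by blast
  then have "k j \<noteq> 0" if "j \<in> u" for j
    using that by (auto simp: dual_lattice_def)
  then have "0 < decay \<alpha> \<gamma> u k"
    unfolding decay_def using \<gamma>u by (intro mult_pos_pos prod_pos) auto
  then have R: "0 < R"
    using decay_le[OF u k] by linarith
  then show "rho \<alpha> \<gamma> s N z > 0"
    by (simp add: R_def)
  show "long_dual N z u (\<gamma> u powr (1 / (2 * \<alpha>)) / rho \<alpha> \<gamma> s N z powr (1 / (2 * \<alpha>)))"
    unfolding long_dual_def R_def[symmetric]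
  proof (intro allI impI)
    fix d assume d: "\<exists>j\<in>u. d j \<noteq> 0" "int N dvd (\<Sum>j\<in>u. d j * int (z j))"
    \<comment> \<open>Passing to the support is needed because \<open>dual_lattice\<close> demands
      non-zero entries; monotonicity of the weights then replaces \<open>\<gamma> v\<close> by
      \<open>\<gamma> u\<close>.\<close>
    define v where "v = {j \<in> u. d j \<noteq> 0}"
    define P where "P = (\<Prod>j\<in>v. real_of_int \<bar>d j\<bar>)"
    have v: "v \<noteq> {}" "v \<subseteq> u"
      using d(1) by (auto simp: v_def)
    then have vS: "v \<in> nonempty_subsets s"
      using u by (auto simp: nonempty_subsets_def)
    have "(\<Sum>j\<in>v. restrict d v j * int (z j)) = (\<Sum>j\<in>u. d j * int (z j))"
      using fin[OF u] by (intro sum.mono_neutral_cong_left) (auto simp: v_def)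
    then have "restrict d v \<in> dual_lattice N z v"
      using d(2) by (auto simp: dual_lattice_def v_def cong_0_iff)
    then have "decay \<alpha> \<gamma> v (restrict d v) \<le> R"
      using decay_le vS by blast
    moreover have "decay \<alpha> \<gamma> v (restrict d v) = \<gamma> v * P powr (- 2 * \<alpha>)"
      unfolding decay_def P_def by (simp add: prod_powr_distrib)
    ultimately have "\<gamma> v * P powr (- 2 * \<alpha>) \<le> R"
      by simp
    moreover have "\<gamma> u * P powr (- 2 * \<alpha>) \<le> \<gamma> v * P powr (- 2 * \<alpha>)"
      using mono[OF v] by (intro mult_right_mono) auto
    ultimately have "\<gamma> u * P powr (- 2 * \<alpha>) \<le> R"
      by linarith
    moreover have P: "P > 0"
      unfolding P_def by (intro prod_pos) (auto simp: v_def)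
    ultimately have "\<gamma> u / R \<le> P powr (2 * \<alpha>)"
      using R by (simp add: powr_minus field_simps)
    then have "(\<gamma> u / R) powr (1 / (2 * \<alpha>)) \<le> (P powr (2 * \<alpha>)) powr (1 / (2 * \<alpha>))"
      using \<gamma>u R \<alpha> by (intro powr_mono2) auto
    also have "\<dots> = P"
      using P \<alpha> by (simp add: powr_powr)
    also have "P = (\<Prod>j\<in>u. real_of_int (max 1 \<bar>d j\<bar>))"
      unfolding P_def using fin[OF u]
      by (intro prod.mono_neutral_cong_left) (auto simp: v_def max_def)
    finally show "\<gamma> u powr (1 / (2 * \<alpha>)) / R powr (1 / (2 * \<alpha>)) \<le> (\<Prod>j\<in>u. real_of_int (max 1 \<bar>d j\<bar>))"
      using \<gamma>u R by (simp add: powr_divide)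
  qed
qed

theorem theorem2:
  fixes s N :: nat and z :: "nat \<Rightarrow> nat" and \<alpha> :: real and \<gamma> \<gamma>' :: "nat set \<Rightarrow> real"
  assumes "s \<ge> 1" and "N \<ge> 1"
    and "z \<in> {1..s} \<rightarrow> {1..N - 1}"
    and "\<alpha> > 1 / 2"
    and "\<And>u. finite u \<Longrightarrow> u \<noteq> {} \<Longrightarrow> 0 \<notin> u \<Longrightarrow> \<gamma> u \<ge> 0"
    and "\<And>u. finite u \<Longrightarrow> u \<noteq> {} \<Longrightarrow> 0 \<notin> u \<Longrightarrow> \<gamma>' u \<ge> 0"
    and "\<And>u v. finite u \<Longrightarrow> 0 \<notin> u \<Longrightarrow> v \<noteq> {} \<Longrightarrow> v \<subset> u \<Longrightarrow> \<gamma> v \<ge> \<gamma> u"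
  shows "ereal (weighted_star_discrepancy \<gamma>' s N (lattice_points N z)) \<le>
    (if \<exists>u\<in>nonempty_subsets s. \<gamma> u = 0 \<and> 0 < \<gamma>' u then \<infinity>
     else ereal (\<Sum>u\<in>nonempty_subsets s. \<gamma>' u *
       (1 - (1 - 1 / real N) ^ card u
        + rho \<alpha> \<gamma> s N z powr (1 / (2 * \<alpha>)) / (2 * \<gamma> u powr (1 / (2 * \<alpha>)))
          * (ln 2 * log 2 (real N) ^ card u + 3 * (2 * log 2 (real N)) ^ (card u - 1)))))"
proof (cases "\<exists>u\<in>nonempty_subsets s. \<gamma> u = 0 \<and> 0 < \<gamma>' u")
  case True
  then show ?thesis by simp
next
  case False
  define S where "S = nonempty_subsets s"
  define R where "R = rho \<alpha> \<gamma> s N z powr (1 / (2 * \<alpha>))"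
  define B where "B m = ln 2 * log 2 (real N) ^ m + 3 * (2 * log 2 (real N)) ^ (m - 1)" for m
  define b where "b u = 1 - (1 - 1 / real N) ^ card u + R / (2 * \<gamma> u powr (1 / (2 * \<alpha>))) * B (card u)"
    for u
  define D where "D u = (SUP y\<in>(\<Pi>\<^sub>E j\<in>u. {0..<1}).
      \<bar>local_discrepancy N (projection u (lattice_points N z)) u y\<bar>)" for u
  have "z 1 \<in> {1..N - 1}"
    using assms(1,3) by auto
  then have N: "N \<ge> 2"
    by auto
  have S: "finite S" "S \<noteq> {}"
    using assms(1) by (auto simp: S_def nonempty_subsets_def)
  have memS: "finite u" "u \<noteq> {}" "0 \<notin> u" if "u \<in> S" for u
    using that finite_subset[of u "{1..s}"] by (auto simp: S_def nonempty_subsets_def)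
  have B_nonneg: "0 \<le> B m" for m
    using N by (auto simp: B_def intro!: add_nonneg_nonneg mult_nonneg_nonneg zero_le_power)
  have b_ge: "1 - (1 - 1 / real N) ^ card u \<ge> 0" for u
    using N by (simp add: power_le_one)
  have b_nonneg: "0 \<le> b u" for u
    using b_ge[of u] B_nonneg by (auto simp: b_def R_def intro!: add_nonneg_nonneg mult_nonneg_nonneg)
  have main: "\<gamma>' u * D u \<le> \<gamma>' u * b u" if u: "u \<in> S" for u
  \<comment> \<open>With \<open>\<gamma>' u = 0\<close> both sides vanish whatever
    \<open>\<gamma> u\<close> is, in accordance with \<open>0/0 = 0\<close>.\<close>
  proof (cases "\<gamma>' u = 0")
    case True
    then show ?thesis by simp
  next
    case \<gamma>': False
    then have "0 < \<gamma>' u"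
      using assms(6)[of u] memS[OF u] by simp
    then have \<gamma>: "0 < \<gamma> u"
      using assms(5)[of u] memS[OF u] False u by (force simp: S_def)
    define \<tau> where "\<tau> = \<gamma> u powr (1 / (2 * \<alpha>)) / R"
    have mono: "\<gamma> u \<le> \<gamma> v" if "v \<noteq> {}" "v \<subseteq> u" for v
      using assms(7)[of u v] memS[OF u] that by (cases "v = u") auto
    have \<rho>: "rho \<alpha> \<gamma> s N z > 0" and long: "long_dual N z u \<tau>"
      unfolding \<tau>_def R_def
      using dual_prod_ge[of N \<alpha> u s \<gamma> z] assms(2,4,5) u \<gamma> memS mono by (auto simp: S_def)
    have \<tau>: "0 < \<tau>"
      using \<rho> \<gamma> by (simp add: \<tau>_def R_def)
    have b_eq: "b u = 1 - (1 - 1 / real N) ^ card u + B (card u) / (2 * \<tau>)"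
      using \<rho> \<gamma> by (simp add: b_def \<tau>_def R_def field_simps)
    have "D u \<le> b u"
      unfolding D_def
    proof (rule cSUP_least)
      show "(\<Pi>\<^sub>E j\<in>u. {0..<1}) \<noteq> ({} :: (nat \<Rightarrow> real) set)"
        by (simp add: PiE_eq_empty_iff)
    next
      fix y :: "nat \<Rightarrow> real" assume y: "y \<in> (\<Pi>\<^sub>E j\<in>u. {0..<1})"
      show "\<bar>local_discrepancy N (projection u (lattice_points N z)) u y\<bar> \<le> b u"
      \<comment> \<open>If \<open>B (card u) \<ge> 2 * \<tau>\<close>, the claimed bound is at least
        the trivial bound 1.\<close>
      proof (cases "B (card u) < 2 * \<tau>")
        case True
        then show ?thesis
          unfolding b_eq B_def using memS[OF u] N long y by (intro local_discrepancy_lattice_le) auto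
      next
        case False
        then have "1 \<le> B (card u) / (2 * \<tau>)"
          using \<tau> by simp
        then show ?thesis
          using local_discrepancy_bound[OF y, of N "projection u (lattice_points N z)"] b_ge[of u]
          unfolding b_eq by linarith
      qed
    qed
    then show ?thesis
      using \<open>0 < \<gamma>' u\<close> by (intro mult_left_mono) auto
  qed
  have "weighted_star_discrepancy \<gamma>' s N (lattice_points N z) \<in> (\<lambda>u. \<gamma>' u * D u) ` S"
    unfolding weighted_star_discrepancy_def S_def[symmetric] D_def[symmetric]
    using S by (intro Max_in) auto
  then obtain u where u: "u \<in> S" "weighted_star_discrepancy \<gamma>' s N (lattice_points N z) = \<gamma>' u * D u"
    by blast
  have "\<gamma>' u * D u \<le> \<gamma>' u * b u"
    using main u(1) by blast
  also have "\<dots> \<le> (\<Sum>u\<in>S. \<gamma>' u * b u)"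
    using S u(1) b_nonneg assms(6) memS by (intro member_le_sum) auto
  finally show ?thesis
    using False u(2) unfolding b_def B_def R_def S_def by simp
qed

end
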